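(* Every linear operator on a finite dimensional complex Hilbert space is similar to a co-analytic truncated Toeplitz operator; that is, for every linear operator $T$ on a finite dimensional complex Hilbert space $\mathcal{H}$ there exist a non-constant inner function $\Theta$, a function $\psi \in H^\infty$, and an invertible linear map $X : \mathcal{H} \to \mathcal{K}_\Theta$ such that $X T X^{-1} = A^{\Theta}_{\overline{\psi}}$.
   Context: Hilbert spaces are assumed nonzero. $\mathbb{D}$ is the open unit disk, $\partial\mathbb{D}$ the unit circle, $L^2=L^2(\partial\mathbb{D})$ with respect to normalized Lebesgue measure, and $H^2$, $H^\infty$ are the classical Hardy spaces on $\mathbb{D}$ ($H^2$ is regarded as a closed subspace of $L^2$ via boundary values). For a non-constant inner function $\Theta$, the model space is $\mathcal{K}_\Theta := H^2 \ominus \Theta H^2$, and $P_\Theta$ is the orthogonal projection of $L^2$ onto $\mathcal{K}_\Theta$. For bounded measurable $\varphi$ on $\partial\mathbb{D}$, the truncated Toeplitz operator $A^\Theta_\varphi : \mathcal{K}_\Theta \to \mathcal{K}_\Theta$ is $A^\Theta_\varphi f = P_\Theta(\varphi f)$. A co-analytic truncated Toeplitz operator on $\mathcal{K}_\Theta$ is one of the form $A^\Theta_{\overline{\psi}}$ with $\psi \in H^\infty$. *)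

theory Defs
  imports "HOL-Complex_Analysis.Complex_Analysis"
begin

section \<open>Complex inner product spaces\<close>

class complex_vector = real_vector +
  fixes scaleC :: "complex \<Rightarrow> 'a \<Rightarrow> 'a"  (infixr "*\<^sub>C" 75)
  assumes scaleC_add_right: "c *\<^sub>C (x + y) = c *\<^sub>C x + c *\<^sub>C y"
    and scaleC_add_left: "(c + d) *\<^sub>C x = c *\<^sub>C x + d *\<^sub>C x"
    and scaleC_scaleC: "c *\<^sub>C (d *\<^sub>C x) = (c * d) *\<^sub>C x"
    and scaleC_one: "1 *\<^sub>C x = x"
    and scaleR_scaleC: "r *\<^sub>R x = complex_of_real r *\<^sub>C x"

text \<open>The inner product is linear in the first argument. Positive definiteness, the norm and the
  metric come from the class \<^class>\<open>real_inner\<close>, whose inner product is the real part of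
  the complex one. A complex Hilbert space is a type of sort \<open>{complex_inner, complete_space}\<close>.\<close>

class complex_inner = complex_vector + real_inner +
  fixes cinner :: "'a \<Rightarrow> 'a \<Rightarrow> complex"
  assumes cinner_commute: "cinner x y = cnj (cinner y x)"
    and cinner_add_left: "cinner (x + y) z = cinner x z + cinner y z"
    and cinner_scaleC_left: "cinner (c *\<^sub>C x) y = c * cinner x y"
    and inner_eq_Re_cinner: "inner x y = Re (cinner x y)"

lemma vector_space_scaleC: "vector_space (scaleC :: complex \<Rightarrow> 'a \<Rightarrow> 'a::complex_vector)"
  by unfold_locales (simp_all add: scaleC_add_right scaleC_add_left scaleC_scaleC scaleC_one)

abbreviation clinear :: "('a::complex_vector \<Rightarrow> 'b::complex_vector) \<Rightarrow> bool"
  where "clinear \<equiv> Vector_Spaces.linear scaleC scaleC"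

definition orth_proj :: "'a::complex_inner set \<Rightarrow> 'a \<Rightarrow> 'a"
  where "orth_proj M x = (THE y. y \<in> M \<and> (\<forall>z\<in>M. cinner (x - y) z = 0))"


section \<open>The space $L^2$ of the unit circle\<close>

text \<open>The space of this measure is the circle itself, so that the values of a function away from
  the circle do not affect its measurability or its integral.\<close>

definition circle :: "complex measure"
  where "circle = distr (uniform_measure lborel {0..2 * pi})
                        (restrict_space borel (sphere 0 1)) cis"

lemma space_circle [simp]: "space circle = sphere 0 1"
  by (simp add: circle_def space_restrict_space)

lemma sets_circle [measurable_cong]: "sets circle = sets (restrict_space borel (sphere 0 1))"
  by (simp add: circle_def)

lemma emeasure_space_circle: "emeasure circle (space circle) = 1"
proof -
  have "cis \<in> measurable (uniform_measure lborel {0..2 * pi}) (restrict_space borel (sphere 0 1))"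
  proof (rule measurable_restrict_space2)
    have "cis \<in> borel_measurable borel"
      by (intro borel_measurable_continuous_onI continuous_on_cis continuous_on_id)
    then show "cis \<in> borel_measurable (uniform_measure lborel {0..2 * pi})"
      by (simp add: measurable_def)
  qed simp
  then have "emeasure circle (space circle) =
      emeasure (uniform_measure lborel {0..2 * pi}) (cis -` sphere 0 1)"
    by (simp add: circle_def emeasure_distr space_restrict_space sets_restrict_space_iff)
  also have "cis -` sphere 0 1 = (UNIV :: real set)"
    by auto
  finally show ?thesis
    by (simp add: ennreal_divide_self)
qed

definition L2_fun :: "(complex \<Rightarrow> complex) \<Rightarrow> bool"
  where "L2_fun f \<longleftrightarrow>
    f \<in> borel_measurable circle \<and> integrable circle (\<lambda>z. (cmod (f z))\<^sup>2)"

definition L2_eq :: "(complex \<Rightarrow> complex) \<Rightarrow> (complex \<Rightarrow> complex) \<Rightarrow> bool"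
  where "L2_eq f g \<longleftrightarrow> L2_fun f \<and> L2_fun g \<and> (AE z in circle. f z = g z)"

lemma borel_measurable_cnj [measurable (raw)]:
  "f \<in> borel_measurable M \<Longrightarrow> (\<lambda>x. cnj (f x)) \<in> borel_measurable M"
  by (rule borel_measurable_continuous_on[of cnj]) (auto intro: continuous_intros)

lemma L2_fun_0: "L2_fun (\<lambda>_. 0)"
  by (simp add: L2_fun_def)

lemma L2_fun_add:
  assumes "L2_fun f" "L2_fun g"
  shows "L2_fun (\<lambda>z. f z + g z)"
proof -
  have [measurable]: "f \<in> borel_measurable circle" "g \<in> borel_measurable circle"
    using assms by (auto simp: L2_fun_def)
  have "integrable circle (\<lambda>z. 2 * (cmod (f z))\<^sup>2 + 2 * (cmod (g z))\<^sup>2)"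
    using assms by (auto simp: L2_fun_def)
  then have "integrable circle (\<lambda>z. (cmod (f z + g z))\<^sup>2)"
  proof (rule Bochner_Integration.integrable_bound)
    have "(cmod (f z + g z))\<^sup>2 \<le> 2 * (cmod (f z))\<^sup>2 + 2 * (cmod (g z))\<^sup>2" for z
    proof -
      have "(cmod (f z + g z))\<^sup>2 \<le> (cmod (f z) + cmod (g z))\<^sup>2"
        by (intro power_mono norm_triangle_ineq) auto
      also have "\<dots> \<le> 2 * (cmod (f z))\<^sup>2 + 2 * (cmod (g z))\<^sup>2"
        using zero_le_power2[of "cmod (f z) - cmod (g z)"]
        by (simp add: power2_eq_square algebra_simps)
      finally show ?thesis .
    qed
    then show "AE z in circle. norm ((cmod (f z + g z))\<^sup>2)
        \<le> norm (2 * (cmod (f z))\<^sup>2 + 2 * (cmod (g z))\<^sup>2)"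
      by auto
  qed measurable
  then show ?thesis
    by (simp add: L2_fun_def)
qed

lemma L2_fun_scale:
  assumes "L2_fun f"
  shows "L2_fun (\<lambda>z. c * f z)"
  using assms by (auto simp: L2_fun_def norm_mult power_mult_distrib)

lemma L2_fun_uminus: "L2_fun f \<Longrightarrow> L2_fun (\<lambda>z. - f z)"
  using L2_fun_scale[of f "-1"] by simp

lemma L2_fun_diff: "L2_fun f \<Longrightarrow> L2_fun g \<Longrightarrow> L2_fun (\<lambda>z. f z - g z)"
  using L2_fun_add[of f "\<lambda>z. - g z"] L2_fun_uminus[of g] by simp

lemma L2_fun_integrable_mult_cnj:
  assumes "L2_fun f" "L2_fun g"
  shows "integrable circle (\<lambda>z. f z * cnj (g z))"
proof -
  have [measurable]: "f \<in> borel_measurable circle" "g \<in> borel_measurable circle"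
    using assms by (auto simp: L2_fun_def)
  have "integrable circle (\<lambda>z. (cmod (f z))\<^sup>2 + (cmod (g z))\<^sup>2)"
    using assms by (auto simp: L2_fun_def)
  then show ?thesis
  proof (rule Bochner_Integration.integrable_bound)
    have "cmod (f z) * cmod (g z) \<le> (cmod (f z))\<^sup>2 + (cmod (g z))\<^sup>2" for z
    proof -
      have "2 * (cmod (f z) * cmod (g z)) \<le> (cmod (f z))\<^sup>2 + (cmod (g z))\<^sup>2"
        using zero_le_power2[of "cmod (f z) - cmod (g z)"]
        by (simp add: power2_eq_square algebra_simps)
      moreover have "0 \<le> cmod (f z) * cmod (g z)"
        by simp
      ultimately show ?thesis
        by linarith
    qed
    then show "AE z in circle. norm (f z * cnj (g z))
        \<le> norm ((cmod (f z))\<^sup>2 + (cmod (g z))\<^sup>2)"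
      by (auto simp: norm_mult)
  qed measurable
qed

quotient_type circle_L2 = "complex \<Rightarrow> complex" / partial: L2_eq
proof (rule part_equivpI)
  show "\<exists>f. L2_eq f f"
    using L2_fun_0 by (auto simp: L2_eq_def)
  show "symp L2_eq"
    by (auto simp: symp_def L2_eq_def)
  show "transp L2_eq"
    by (auto simp: transp_def L2_eq_def)
qed

instantiation circle_L2 :: complex_inner
begin

lift_definition zero_circle_L2 :: circle_L2 is "\<lambda>_. 0"
  by (simp add: L2_eq_def L2_fun_0)

lift_definition plus_circle_L2 :: "circle_L2 \<Rightarrow> circle_L2 \<Rightarrow> circle_L2"
  is "\<lambda>f g z. f z + g z"
  by (auto simp: L2_eq_def L2_fun_add)

lift_definition minus_circle_L2 :: "circle_L2 \<Rightarrow> circle_L2 \<Rightarrow> circle_L2"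
  is "\<lambda>f g z. f z - g z"
  by (auto simp: L2_eq_def L2_fun_diff)

lift_definition uminus_circle_L2 :: "circle_L2 \<Rightarrow> circle_L2" is "\<lambda>f z. - f z"
  by (auto simp: L2_eq_def L2_fun_uminus)

lift_definition scaleC_circle_L2 :: "complex \<Rightarrow> circle_L2 \<Rightarrow> circle_L2"
  is "\<lambda>c f z. c * f z"
  by (auto simp: L2_eq_def L2_fun_scale)

definition scaleR_circle_L2 :: "real \<Rightarrow> circle_L2 \<Rightarrow> circle_L2"
  where "scaleR_circle_L2 r F = complex_of_real r *\<^sub>C F"

lift_definition cinner_circle_L2 :: "circle_L2 \<Rightarrow> circle_L2 \<Rightarrow> complex"
  is "\<lambda>f g. LINT z|circle. f z * cnj (g z)"
  by (rule integral_cong_AE)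
     (auto simp: L2_eq_def L2_fun_def intro!: borel_measurable_times borel_measurable_cnj)

definition inner_circle_L2 :: "circle_L2 \<Rightarrow> circle_L2 \<Rightarrow> real"
  where "inner_circle_L2 F G = Re (cinner F G)"

definition norm_circle_L2 :: "circle_L2 \<Rightarrow> real"
  where "norm_circle_L2 F = sqrt (inner F F)"

definition sgn_circle_L2 :: "circle_L2 \<Rightarrow> circle_L2"
  where "sgn_circle_L2 F = inverse (norm F) *\<^sub>R F"

definition dist_circle_L2 :: "circle_L2 \<Rightarrow> circle_L2 \<Rightarrow> real"
  where "dist_circle_L2 F G = norm (F - G)"

definition uniformity_circle_L2 :: "(circle_L2 \<times> circle_L2) filter"
  where "uniformity_circle_L2 = (INF e\<in>{0<..}. principal {(F, G). dist F G < e})"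

definition open_circle_L2 :: "circle_L2 set \<Rightarrow> bool"
  where "open_circle_L2 U \<longleftrightarrow>
    (\<forall>F\<in>U. eventually (\<lambda>(F', G). F' = F \<longrightarrow> G \<in> U) uniformity)"

instance
proof
  fix F G K :: circle_L2 and c d :: complex and a b :: real
  show "F + G + K = F + (G + K)"
    by transfer (auto simp: L2_eq_def L2_fun_add add.assoc)
  show "F + G = G + F"
    by transfer (auto simp: L2_eq_def L2_fun_add add.commute)
  show "0 + F = F"
    by transfer (auto simp: L2_eq_def)
  show "- F + F = 0"
    by transfer (auto simp: L2_eq_def L2_fun_0)
  show "F - G = F + - G"
    by transfer (auto simp: L2_eq_def L2_fun_diff)
  show C1: "c *\<^sub>C (F + G) = c *\<^sub>C F + c *\<^sub>C G" for c and F G :: circle_L2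
    by transfer (auto simp: L2_eq_def L2_fun_add L2_fun_scale distrib_left)
  show C2: "(c + d) *\<^sub>C F = c *\<^sub>C F + d *\<^sub>C F" for c d and F :: circle_L2
    by transfer (auto simp: L2_eq_def L2_fun_add L2_fun_scale distrib_right)
  show C3: "c *\<^sub>C (d *\<^sub>C F) = (c * d) *\<^sub>C F" for c d and F :: circle_L2
    by transfer (auto simp: L2_eq_def L2_fun_scale mult.assoc)
  show C4: "1 *\<^sub>C F = F" for F :: circle_L2
    by transfer (auto simp: L2_eq_def)
  show R: "a *\<^sub>R F = complex_of_real a *\<^sub>C F" for a and F :: circle_L2
    by (simp add: scaleR_circle_L2_def)
  show "a *\<^sub>R (F + G) = a *\<^sub>R F + a *\<^sub>R G"
    by (simp add: R C1)
  show "(a + b) *\<^sub>R F = a *\<^sub>R F + b *\<^sub>R F"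
    by (simp add: R C2)
  show "a *\<^sub>R b *\<^sub>R F = (a * b) *\<^sub>R F"
    by (simp add: R C3)
  show "1 *\<^sub>R F = F"
    by (simp add: R C4)
  show "dist F G = norm (F - G)"
    by (simp add: dist_circle_L2_def)
  show "sgn F = inverse (norm F) *\<^sub>R F"
    by (simp add: sgn_circle_L2_def)
  show "uniformity = (INF e\<in>{0<..}. principal {(F, G :: circle_L2). dist F G < e})"
    by (simp add: uniformity_circle_L2_def)
  show "open U = (\<forall>F\<in>U. \<forall>\<^sub>F (F', G) in uniformity. F' = F \<longrightarrow> G \<in> U)"
    for U :: "circle_L2 set"
    by (simp add: open_circle_L2_def)
  show sym: "cinner F G = cnj (cinner G F)" for F G :: circle_L2
    by transfer (subst Bochner_Integration.integral_cnj [symmetric], simp add: mult.commute)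
  show add: "cinner (F + G) K = cinner F K + cinner G K" for F G K :: circle_L2
    by transfer (simp add: L2_eq_def distrib_right L2_fun_integrable_mult_cnj)
  show scale: "cinner (c *\<^sub>C F) G = c * cinner F G" for c and F G :: circle_L2
    by transfer (simp add: mult.assoc)
  show inner: "inner F G = Re (cinner F G)" for F G :: circle_L2
    by (simp add: inner_circle_L2_def)
  show "inner F G = inner G F"
    using sym[of F G] by (simp add: inner)
  show "inner (F + G) K = inner F K + inner G K"
    by (simp add: inner add)
  show "inner (a *\<^sub>R F) G = a * inner F G"
    by (simp add: inner R scale)
  have sq: "cinner F F = complex_of_real (LINT z|circle. (cmod (rep_circle_L2 F z))\<^sup>2)" for F :: circle_L2
    by (simp only: cinner_circle_L2.rep_eq complex_norm_square flip: integral_complex_of_real)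
  show "0 \<le> inner F F"
    by (simp add: inner sq)
  have "F = 0" if "inner F F = 0"
  proof -
    have L2: "L2_fun (rep_circle_L2 F)"
      using Quotient3_rep_reflp[OF Quotient3_circle_L2, of F] by (simp add: L2_eq_def)
    have "(LINT z|circle. (cmod (rep_circle_L2 F z))\<^sup>2) = 0"
      using that by (simp add: inner sq)
    then have "AE z in circle. rep_circle_L2 F z = 0"
      using L2 by (subst (asm) integral_nonneg_eq_0_iff_AE) (auto simp: L2_fun_def)
    then have "L2_eq (rep_circle_L2 F) (\<lambda>_. 0)"
      using L2 L2_fun_0 by (simp add: L2_eq_def)
    then have "abs_circle_L2 (rep_circle_L2 F) = abs_circle_L2 (\<lambda>_. 0)"
      using Quotient3_rel_abs[OF Quotient3_circle_L2] by blast
    then show ?thesis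
      using Quotient3_abs_rep[OF Quotient3_circle_L2, of F] by (simp add: zero_circle_L2.abs_eq)
  qed
  moreover have "inner (0 :: circle_L2) 0 = 0"
    unfolding inner by transfer simp
  ultimately show "inner F F = 0 \<longleftrightarrow> F = 0"
    by auto
  show "norm F = sqrt (inner F F)"
    by (simp add: norm_circle_L2_def)
qed

end

text \<open>Multiplication of a class in $L^2$ by an (essentially) bounded measurable function; only
  for such functions is the product again in $L^2$ and the result meaningful.\<close>

definition L2_mult :: "(complex \<Rightarrow> complex) \<Rightarrow> circle_L2 \<Rightarrow> circle_L2"
  where "L2_mult \<phi> F = abs_circle_L2 (\<lambda>z. \<phi> z * rep_circle_L2 F z)"


section \<open>Hardy spaces, inner functions and model spaces\<close>

text \<open>Functions on the disk are represented by arbitrary functions on the plane, whose values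
  outside the open unit disk are irrelevant. Boundary values are radial limits.\<close>

definition has_boundary_value :: "(complex \<Rightarrow> complex) \<Rightarrow> complex \<Rightarrow> complex \<Rightarrow> bool"
  where "has_boundary_value f z w \<longleftrightarrow> ((\<lambda>r. f (complex_of_real r * z)) \<longlongrightarrow> w) (at_left 1)"

definition boundary :: "(complex \<Rightarrow> complex) \<Rightarrow> complex \<Rightarrow> complex"
  where "boundary f z = (THE w. has_boundary_value f z w)"

definition Hardy2_disk :: "(complex \<Rightarrow> complex) set"
  where "Hardy2_disk = {f. f holomorphic_on ball 0 1 \<and>
    bdd_above ((\<lambda>r. LINT z|circle. (cmod (f (complex_of_real r * z)))\<^sup>2) ` {0..<1})}"

definition Hardy_inf :: "(complex \<Rightarrow> complex) set"
  where "Hardy_inf = {f. f holomorphic_on ball 0 1 \<and> bounded (f ` ball 0 1)}"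

text \<open>$H^2$ as a subspace of $L^2$: the classes of the boundary functions. By Fatou's theorem every
  member of \<^const>\<open>Hardy2_disk\<close> has a boundary function, and it lies in $L^2$.\<close>

definition Hardy2 :: "circle_L2 set"
  where "Hardy2 = {F. \<exists>f\<in>Hardy2_disk. AE z in circle. has_boundary_value f z (rep_circle_L2 F z)}"

definition inner_function :: "(complex \<Rightarrow> complex) \<Rightarrow> bool"
  where "inner_function \<Theta> \<longleftrightarrow> \<Theta> \<in> Hardy_inf \<and>
    (AE z in circle. \<exists>w. has_boundary_value \<Theta> z w \<and> cmod w = 1)"

definition model_space :: "(complex \<Rightarrow> complex) \<Rightarrow> circle_L2 set"
  where "model_space \<Theta> =
    {F \<in> Hardy2. \<forall>G\<in>L2_mult (boundary \<Theta>) ` Hardy2. cinner F G = 0}"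

definition truncated_Toeplitz ::
    "(complex \<Rightarrow> complex) \<Rightarrow> (complex \<Rightarrow> complex) \<Rightarrow> circle_L2 \<Rightarrow> circle_L2"
  where "truncated_Toeplitz \<Theta> \<phi> F = orth_proj (model_space \<Theta>) (L2_mult \<phi> F)"

end

theory Submission
  imports Defs
    "Jordan_Normal_Form.Jordan_Normal_Form_Existence"
    "HOL-Computational_Algebra.Field_as_Ring"
    "HOL-Computational_Algebra.Polynomial_Factorial"
begin

text \<open>
  The compression of multiplication by $\bar\psi$ to the model space of a finite Blaschke product has
  an explicit Jordan form, and any Jordan form can be realized in this way. Let $\Theta$ have
  zeros at distinct points $a_i$ with multiplicities $n_i$. The functions
  $k_{i,j}(z) = z^j / (1 - \bar a_i z)^{j+1}$ with $j < n_i$ represent the Taylor coefficients at the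
  points $a_i$: the inner product of $f \in H^2$ with $k_{i,j}$ is the $j$-th Taylor coefficient of $f$ at $a_i$.

  They form a basis of the model space (\<open>model_space_eq_span\<close>, \<open>kernels_independent\<close>). Multiples of
  $\Theta$ are orthogonal to them. Conversely, a function orthogonal to all of them vanishes at each $a_i$ to order
  $n_i$, so it is a multiple of $\Theta$; a member of the model space with this property is zero, and
  subtracting its orthogonal projection brings every member into this situation.

  For $f \in H^2$ the inner product of $\bar\psi k_{i,j}$ with $f$ is that of $k_{i,j}$ with $\psi f$, the conjugate of
  the $j$-th Taylor coefficient of $\psi f$ at $a_i$. If $\psi(z) = \bar\lambda_i + (z - a_i)$ up to order
  $n_i$ at $a_i$, this coefficient is $\bar\lambda_i$ times the $j$-th plus the $(j-1)$-st coefficient of $f$, and therefore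
  $A^\Theta_{\bar\psi} k_{i,j} = \lambda_i k_{i,j} + k_{i,j-1}$ with $k_{i,-1} = 0$ (\<open>Taylor_functional_poly_mult\<close>): one
  Jordan block for each zero. Given $T$ with Jordan blocks of sizes $n_i$ and eigenvalues $\lambda_i$
  (\<open>jordan_basis_exists\<close>), distinct points $a_i$ are chosen, a polynomial $\psi$ is obtained from the Chinese
  remainder theorem (\<open>chinese_remainder_poly\<close>), and \<open>X\<close> maps the Jordan basis to the kernels. Equal
  eigenvalues in several blocks do no harm, since $\psi$ may take the same value at several points.

  The analytic input consists of two facts: the mean value property for $H^2$ functions in terms of their
  boundary values (\<open>Hardy_pair_mean_value\<close>), and the closure of $H^2$ under difference quotients
  (\<open>Hardy_pair_difference_quotient\<close>). The Taylor coefficients are introduced as integrals over the circle, and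
  their properties are derived from these two facts by polynomial algebra.
\<close>

section \<open>Integration over the circle\<close>

lemma finite_measure_circle: "finite_measure circle"
  by (rule finite_measureI) (simp only: emeasure_space_circle, simp)

lemma borel_measurable_circle_continuous:
  fixes f :: "complex \<Rightarrow> 'b::topological_space"
  assumes "continuous_on (sphere 0 1) f"
  shows "f \<in> borel_measurable circle"
  using borel_measurable_continuous_on_restrict[OF assms]
  by (simp add: measurable_cong_sets[OF sets_circle refl])

lemma integrable_circle_continuous:
  fixes f :: "complex \<Rightarrow> 'b::{banach, second_countable_topology}"
  assumes "continuous_on (sphere 0 1) f"
  shows "integrable circle f"
proof -
  interpret finite_measure circle by (rule finite_measure_circle)
  have "bounded (f ` sphere 0 1)"
    by (intro compact_imp_bounded compact_continuous_image assms) simp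
  then obtain B where B: "\<And>z. z \<in> sphere 0 1 \<Longrightarrow> norm (f z) \<le> B"
    unfolding bounded_iff by blast
  show ?thesis
    by (rule integrable_const_bound[of _ B])
      (use B borel_measurable_circle_continuous[OF assms] in auto)
qed

lemma cis_measurable_circle:
  "cis \<in> measurable lborel (restrict_space borel (sphere 0 1))"
proof (rule measurable_restrict_space2)
  have "cis \<in> borel_measurable borel"
    by (intro borel_measurable_continuous_onI continuous_on_cis continuous_on_id)
  then show "cis \<in> borel_measurable lborel"
    by simp
qed auto

lemma uniform_measure_interval_eq_density:
  "uniform_measure lborel {0..2 * pi} =
     density lborel (\<lambda>t. ennreal (indicator {0..2 * pi} t / (2 * pi)))"
  unfolding uniform_measure_def
  by (rule arg_cong[where f = "density lborel"])
     (auto simp: fun_eq_iff divide_ennreal[symmetric] split: split_indicator)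

lemma integral_circle_continuous:
  fixes f :: "complex \<Rightarrow> complex"
  assumes "continuous_on (sphere 0 1) f"
  shows "((\<lambda>t. f (cis t)) has_integral (2 * pi) * (LINT z|circle. f z)) {0..2 * pi}"
proof -
  have fm: "f \<in> borel_measurable (restrict_space borel (sphere 0 1))"
    by (rule borel_measurable_continuous_on_restrict[OF assms])
  have cm: "cis \<in> measurable (uniform_measure lborel {0..2 * pi}) (restrict_space borel (sphere 0 1))"
    using cis_measurable_circle by (simp add: measurable_def)
  have cont: "continuous_on {0..2 * pi} (\<lambda>t. f (cis t))"
    by (rule continuous_on_compose2[OF assms]) (auto intro!: continuous_intros)
  have meas: "(\<lambda>t. f (cis t)) \<in> borel_measurable lborel"
    using measurable_compose[OF cis_measurable_circle fm] by simp
  have "(LINT z|circle. f z) = (LINT t|uniform_measure lborel {0..2 * pi}. f (cis t))"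
    unfolding circle_def by (rule integral_distr[OF cm fm])
  also have "\<dots> = (LINT t|lborel. (indicator {0..2 * pi} t / (2 * pi)) *\<^sub>R f (cis t))"
    unfolding uniform_measure_interval_eq_density
    by (rule integral_density[OF meas]) (auto split: split_indicator)
  also have "\<dots> = (LINT t|lborel. (1 / (2 * pi)) *\<^sub>R (indicator {0..2 * pi} t *\<^sub>R f (cis t)))"
    by (simp add: field_simps)
  also have "\<dots> = (1 / (2 * pi)) *\<^sub>R (LINT t:{0..2 * pi}|lborel. f (cis t))"
    unfolding set_lebesgue_integral_def by (rule integral_scaleR_right)
  finally have 1: "(2 * pi) * (LINT z|circle. f z) = (LINT t:{0..2 * pi}|lborel. f (cis t))"
    by (simp add: scaleR_conv_of_real)
  have "set_integrable lborel {0..2 * pi} (\<lambda>t. f (cis t))"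
    using borel_integrable_atLeastAtMost'[OF cont] .
  from set_borel_integral_eq_integral[OF this] show ?thesis
    unfolding 1 by (simp add: has_integral_iff)
qed

lemma mean_value_dilate:
  assumes hol: "f holomorphic_on ball 0 1" and r: "0 \<le> r" "r < 1"
  shows "(LINT z|circle. f (complex_of_real r * z)) = f 0"
proof -
  define g where "g z = f (complex_of_real r * z)" for z
  have hg: "g holomorphic_on cball 0 1"
    unfolding g_def
  proof (rule holomorphic_on_compose_gen[of _ _ f "ball 0 1", unfolded o_def])
    show "(\<lambda>z. complex_of_real r * z) ` cball 0 1 \<subseteq> ball 0 1"
      using r mult_left_le[of _ r] by (force simp: norm_mult)
  qed (auto intro!: holomorphic_intros hol)
  have "((\<lambda>u. g u / (u - 0)) has_contour_integral (2 * of_real pi * \<i> * g 0)) (circlepath 0 1)"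
    by (rule Cauchy_integral_circlepath_simple[OF hg]) auto
  then have "((\<lambda>t. g (cis t) / cis t * \<i> * cis t) has_integral (2 * of_real pi * \<i> * g 0)) {0..2 * pi}"
    by (simp add: circlepath_def has_contour_integral_part_circlepath_iff)
  then have "((\<lambda>t. (- \<i>) * (g (cis t) / cis t * \<i> * cis t)) has_integral ((- \<i>) * (2 * of_real pi * \<i> * g 0))) {0..2 * pi}"
    by (rule has_integral_mult_right)
  then have 1: "((\<lambda>t. g (cis t)) has_integral (2 * of_real pi * g 0)) {0..2 * pi}"
    by (simp add: field_simps)
  have "((\<lambda>t. g (cis t)) has_integral (2 * pi) * (LINT z|circle. g z)) {0..2 * pi}"
    by (intro integral_circle_continuous holomorphic_on_imp_continuous_on holomorphic_on_subset[OF hg]) auto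
  from has_integral_unique[OF this 1] show ?thesis
    by (simp add: g_def)
qed

text \<open>An instance of Vitali's convergence theorem: a bound in $L^2$ makes the sequence uniformly
  integrable. The differences are cut off at a height $K$; the part below $K$ is handled by
  dominated convergence, and the part above is bounded by the square divided by $K$.\<close>

lemma (in finite_measure) tendsto_integral_L2_bounded:
  fixes f :: "nat \<Rightarrow> 'a \<Rightarrow> complex" and F :: "'a \<Rightarrow> complex"
  assumes f [measurable]: "\<And>n. f n \<in> borel_measurable M"
    and F [measurable]: "F \<in> borel_measurable M"
    and fi: "\<And>n. integrable M (\<lambda>x. (cmod (f n x))\<^sup>2)" and Fi: "integrable M (\<lambda>x. (cmod (F x))\<^sup>2)"
    and C: "\<And>n. (LINT x|M. (cmod (f n x))\<^sup>2) \<le> C"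
    and lim: "AE x in M. (\<lambda>n. f n x) \<longlonglongrightarrow> F x"
  shows "(\<lambda>n. LINT x|M. f n x) \<longlonglongrightarrow> (LINT x|M. F x)"
proof -
  define d where "d n x = cmod (f n x - F x)" for n x
  have [measurable]: "d n \<in> borel_measurable M" for n
    unfolding d_def by measurable
  define D where "D = 2 * C + 2 * (LINT x|M. (cmod (F x))\<^sup>2)"
  have d2: "(d n x)\<^sup>2 \<le> 2 * (cmod (f n x))\<^sup>2 + 2 * (cmod (F x))\<^sup>2" for n x
  proof -
    have "(d n x)\<^sup>2 \<le> (cmod (f n x) + cmod (F x))\<^sup>2"
      unfolding d_def by (intro power_mono norm_triangle_ineq4) auto
    also have "\<dots> \<le> 2 * (cmod (f n x))\<^sup>2 + 2 * (cmod (F x))\<^sup>2"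
      using zero_le_power2[of "cmod (f n x) - cmod (F x)"]
      by (simp add: power2_eq_square algebra_simps)
    finally show ?thesis .
  qed
  have d2i: "integrable M (\<lambda>x. (d n x)\<^sup>2)" for n
    by (rule Bochner_Integration.integrable_bound[of _ "\<lambda>x. 2 * (cmod (f n x))\<^sup>2 + 2 * (cmod (F x))\<^sup>2"])
      (use fi Fi d2 in auto)
  have d2D: "(LINT x|M. (d n x)\<^sup>2) \<le> D" for n
  proof -
    have "(LINT x|M. (d n x)\<^sup>2) \<le> (LINT x|M. 2 * (cmod (f n x))\<^sup>2 + 2 * (cmod (F x))\<^sup>2)"
      using fi Fi d2 d2i by (intro integral_mono) auto
    also have "\<dots> \<le> D"
      using fi Fi C[of n] by (simp add: D_def)
    finally show ?thesis .
  qed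
  have D0: "D \<ge> 0"
    using order_trans[OF _ d2D[of 0]] by simp
  have L2_integrable: "integrable M h"
    if [measurable]: "h \<in> borel_measurable M" and h2: "integrable M (\<lambda>x. (cmod (h x))\<^sup>2)"
    for h :: "'a \<Rightarrow> complex"
  proof (rule Bochner_Integration.integrable_bound[of _ "\<lambda>x. 1 + (cmod (h x))\<^sup>2"])
    have "cmod (h x) \<le> 1 + (cmod (h x))\<^sup>2" for x
    proof -
      have "2 * cmod (h x) \<le> 1 + (cmod (h x))\<^sup>2"
        using zero_le_power2[of "cmod (h x) - 1"] by (simp add: power2_eq_square algebra_simps)
      then show ?thesis
        using norm_ge_zero[of "h x"] by linarith
    qed
    then show "AE x in M. norm (h x) \<le> norm (1 + (cmod (h x))\<^sup>2)"
      by auto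
  qed (use h2 in auto)
  have fi1: "integrable M (f n)" for n
    by (rule L2_integrable[OF f fi])
  have Fi1: "integrable M F"
    by (rule L2_integrable[OF F Fi])
  have di: "integrable M (d n)" for n
    unfolding d_def using fi1 Fi1 by auto
  have min_lim: "(\<lambda>n. LINT x|M. min (d n x) K) \<longlonglongrightarrow> (LINT x|M. 0)" if "K > 0" for K :: real
  proof (rule integral_dominated_convergence[where w = "\<lambda>_. K"])
    show "AE x in M. (\<lambda>n. min (d n x) K) \<longlonglongrightarrow> 0"
      using lim
    proof eventually_elim
      case (elim x)
      then have "(\<lambda>n. d n x) \<longlonglongrightarrow> 0"
        unfolding d_def using tendsto_norm_zero LIM_zero by blast
      then have "(\<lambda>n. min (d n x) K) \<longlonglongrightarrow> min 0 K"
        by (intro tendsto_min tendsto_const)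
      with that show ?case
        by simp
    qed
    show "AE x in M. norm (min (d n x) K) \<le> K" for n
      using that by (auto simp: d_def)
  qed auto
  have "(\<lambda>n. LINT x|M. d n x) \<longlonglongrightarrow> 0"
  proof (rule LIMSEQ_I)
    fix e :: real assume "e > 0"
    \<comment> \<open>This height makes the part above it contribute at most \<open>D / K < e / 2\<close>.\<close>
    define K where "K = 2 * D / e + 1"
    have K: "K > 0"
      using \<open>e > 0\<close> D0 by (simp add: K_def add_nonneg_pos)
    have DK: "D / K < e / 2"
    proof -
      have "K * e = 2 * D + e"
        using \<open>e > 0\<close> by (simp add: K_def field_simps)
      then show ?thesis
        using K \<open>e > 0\<close> by (simp add: field_simps)
    qed
    from min_lim[OF K] \<open>e > 0\<close> obtain N where N: "\<And>n. n \<ge> N \<Longrightarrow> norm ((LINT x|M. min (d n x) K) - 0) < e / 2"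
      using LIMSEQ_D[of "\<lambda>n. LINT x|M. min (d n x) K" 0 "e / 2"] by auto
    have "norm ((LINT x|M. d n x) - 0) < e" if "n \<ge> N" for n
    proof -
      have mi: "integrable M (\<lambda>x. min (d n x) K)"
        by (rule Bochner_Integration.integrable_bound[OF di[of n]]) (use K in \<open>auto simp: d_def\<close>)
      have "d n x \<le> min (d n x) K + (d n x)\<^sup>2 / K" for x
      proof (cases "d n x \<le> K")
        case False
        then have "d n x * K \<le> d n x * d n x"
          by (intro mult_left_mono) (auto simp: d_def)
        then have "d n x \<le> (d n x)\<^sup>2 / K"
          using K by (simp add: field_simps power2_eq_square)
        then show ?thesis
          using False K by simp
      qed (use K in auto)
      then have "(LINT x|M. d n x) \<le> (LINT x|M. min (d n x) K + (d n x)\<^sup>2 / K)"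
        using di mi d2i by (intro integral_mono) auto
      also have "\<dots> = (LINT x|M. min (d n x) K) + (LINT x|M. (d n x)\<^sup>2) / K"
        using mi d2i by simp
      also have "\<dots> \<le> (LINT x|M. min (d n x) K) + D / K"
        using d2D[of n] K by (simp add: divide_right_mono)
      also have "\<dots> < e"
        using abs_ge_self[of "LINT x|M. min (d n x) K"] N[OF that] DK
        unfolding real_norm_def diff_0_right by linarith
      finally have "(LINT x|M. d n x) < e" .
      moreover have "0 \<le> (LINT x|M. d n x)"
        by (simp add: d_def)
      ultimately show ?thesis
        by simp
    qed
    then show "\<exists>no. \<forall>n\<ge>no. norm ((LINT x|M. d n x) - 0) < e"
      by blast
  qed
  then have "(\<lambda>n. (LINT x|M. f n x) - (LINT x|M. F x)) \<longlonglongrightarrow> 0"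
  proof (rule Lim_null_comparison[rotated], intro always_eventually allI)
    fix n
    have "norm ((LINT x|M. f n x) - (LINT x|M. F x)) = norm (LINT x|M. f n x - F x)"
      using fi1 Fi1 by simp
    also have "\<dots> \<le> (LINT x|M. d n x)"
      unfolding d_def by (rule integral_norm_bound)
    finally show "norm ((LINT x|M. f n x) - (LINT x|M. F x)) \<le> (LINT x|M. d n x)" .
  qed
  then show ?thesis
    by (rule LIM_zero_cancel)
qed

section \<open>Hardy space functions and their boundary values\<close>

text \<open>An element of $H^2$ in $L^2$ is a class of boundary functions and does not display the
  holomorphic function from which it comes. The pair keeps both, so that algebra can be done on the
  boundary while the values in the disk remain available.\<close>

definition Hardy_pair :: "(complex \<Rightarrow> complex) \<Rightarrow> (complex \<Rightarrow> complex) \<Rightarrow> bool"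
  where "Hardy_pair f F \<longleftrightarrow>
    f \<in> Hardy2_disk \<and> L2_fun F \<and> (AE z in circle. has_boundary_value f z (F z))"

text \<open>These functions serve as multipliers: they act on $H^2$, and their boundary values are
  their values at every point of the circle. Polynomials, the kernels and finite Blaschke products
  all belong to this class.\<close>

definition disk_algebra :: "(complex \<Rightarrow> complex) \<Rightarrow> bool"
  where "disk_algebra \<phi> \<longleftrightarrow> continuous_on (cball 0 1) \<phi> \<and> \<phi> holomorphic_on ball 0 1"

lemma continuous_on_dilate:
  assumes "f holomorphic_on ball 0 1" "0 \<le> r" "r < 1"
  shows "continuous_on (sphere 0 1) (\<lambda>z. f (complex_of_real r * z))"
  by (rule continuous_on_compose2[OF holomorphic_on_imp_continuous_on[OF assms(1)]])
    (use assms in \<open>auto intro!: continuous_intros simp: norm_mult\<close>)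

lemma integrable_dilate_power2:
  assumes "f holomorphic_on ball 0 1" "0 \<le> r" "r < 1"
  shows "integrable circle (\<lambda>z. (cmod (f (complex_of_real r * z)))\<^sup>2)"
  by (intro integrable_circle_continuous continuous_intros continuous_on_dilate assms)

text \<open>Only the size near the circle decides membership in $H^2$, because a holomorphic function is
  bounded on every smaller closed disk. The radius \<open>\<rho>\<close> is what allows division by a function with
  zeros in the disk.\<close>

lemma Hardy2_disk_dominated:
  assumes f: "f \<in> Hardy2_disk" and g: "g \<in> Hardy2_disk" and h: "h holomorphic_on ball 0 1"
    and \<rho>: "\<rho> < 1" and AB: "A \<ge> 0" "B \<ge> 0"
    and le: "\<And>w. \<rho> \<le> cmod w \<Longrightarrow> cmod w < 1 \<Longrightarrow>
      (cmod (h w))\<^sup>2 \<le> A * (cmod (f w))\<^sup>2 + B * (cmod (g w))\<^sup>2 + C"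
  shows "h \<in> Hardy2_disk"
proof -
  interpret finite_measure circle by (rule finite_measure_circle)
  have m1: "measure circle (space circle) = 1"
    using emeasure_space_circle by (simp add: measure_def)
  have hf: "f holomorphic_on ball 0 1" and hg: "g holomorphic_on ball 0 1"
    using f g by (auto simp: Hardy2_disk_def)
  obtain Mf where Mf: "\<And>r. 0 \<le> r \<Longrightarrow> r < 1 \<Longrightarrow> (LINT z|circle. (cmod (f (complex_of_real r * z)))\<^sup>2) \<le> Mf"
    using f unfolding Hardy2_disk_def bdd_above_def by fastforce
  obtain Mg where Mg: "\<And>r. 0 \<le> r \<Longrightarrow> r < 1 \<Longrightarrow> (LINT z|circle. (cmod (g (complex_of_real r * z)))\<^sup>2) \<le> Mg"
    using g unfolding Hardy2_disk_def bdd_above_def by fastforce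
  have "bounded (h ` cball 0 \<rho>)"
    by (intro compact_imp_bounded compact_continuous_image holomorphic_on_imp_continuous_on
        holomorphic_on_subset[OF h]) (use \<rho> in auto)
  then obtain K where K: "\<And>w. w \<in> cball 0 \<rho> \<Longrightarrow> cmod (h w) \<le> K"
    unfolding bounded_iff by blast
  have "(LINT z|circle. (cmod (h (complex_of_real r * z)))\<^sup>2) \<le> max (A * Mf + B * Mg + C) (K\<^sup>2)"
    if r: "0 \<le> r" "r < 1" for r
  proof (cases "\<rho> \<le> r")
    case True
    have "(LINT z|circle. (cmod (h (complex_of_real r * z)))\<^sup>2) \<le>
        (LINT z|circle. A * (cmod (f (complex_of_real r * z)))\<^sup>2 + B * (cmod (g (complex_of_real r * z)))\<^sup>2 + C)"
      using integrable_dilate_power2[OF h r] integrable_dilate_power2[OF hf r] integrable_dilate_power2[OF hg r]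
      by (intro integral_mono) (use r True in \<open>auto intro!: le simp: norm_mult\<close>)
    also have "\<dots> = A * (LINT z|circle. (cmod (f (complex_of_real r * z)))\<^sup>2)
        + B * (LINT z|circle. (cmod (g (complex_of_real r * z)))\<^sup>2) + C"
      using integrable_dilate_power2[OF hf r] integrable_dilate_power2[OF hg r] m1 by simp
    also have "\<dots> \<le> A * Mf + B * Mg + C"
      using Mf[OF r] Mg[OF r] AB by (intro add_mono mult_left_mono) auto
    finally show ?thesis by simp
  next
    case False
    have "(LINT z|circle. (cmod (h (complex_of_real r * z)))\<^sup>2) \<le> (LINT z|circle. K\<^sup>2)"
      using integrable_dilate_power2[OF h r]
      by (intro integral_mono power_mono K) (use r False in \<open>auto simp: norm_mult\<close>)
    then show ?thesis
      using m1 by simp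
  qed
  then show ?thesis
    using h unfolding Hardy2_disk_def bdd_above_def by fastforce
qed

lemma disk_algebra_bounded:
  assumes "disk_algebra \<phi>"
  obtains B where "\<And>z. cmod z \<le> 1 \<Longrightarrow> cmod (\<phi> z) \<le> B"
proof -
  have "bounded (\<phi> ` cball 0 1)"
    using assms unfolding disk_algebra_def
    by (intro compact_imp_bounded compact_continuous_image) auto
  then show ?thesis
    using that unfolding bounded_iff by fastforce
qed

lemma disk_algebra_boundary_value:
  assumes "disk_algebra \<phi>" "cmod z = 1"
  shows "has_boundary_value \<phi> z (\<phi> z)"
proof -
  have "((\<lambda>r. complex_of_real r * z) \<longlongrightarrow> complex_of_real 1 * z) (at_left 1)"
    by (intro tendsto_intros)
  moreover have "eventually (\<lambda>r. complex_of_real r * z \<in> cball 0 1) (at_left 1)"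
    by (rule eventually_mono[OF eventually_at_left_real[of 0 1]]) (use assms(2) in \<open>auto simp: norm_mult\<close>)
  ultimately show ?thesis
    unfolding has_boundary_value_def
    using assms continuous_on_tendsto_compose[of "cball 0 1" \<phi> "\<lambda>r. complex_of_real r * z" z "at_left 1"]
    by (auto simp: disk_algebra_def)
qed

lemma boundary_unique:
  assumes "has_boundary_value f z w"
  shows "boundary f z = w"
  unfolding boundary_def
proof (rule the_equality)
  fix w' assume "has_boundary_value f z w'"
  with assms show "w' = w"
    unfolding has_boundary_value_def using tendsto_unique trivial_limit_at_left_real by blast
qed (rule assms)

lemma boundary_disk_algebra: "disk_algebra \<phi> \<Longrightarrow> cmod z = 1 \<Longrightarrow> boundary \<phi> z = \<phi> z"
  by (intro boundary_unique disk_algebra_boundary_value)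

lemma disk_algebra_Hardy_inf: "disk_algebra \<phi> \<Longrightarrow> \<phi> \<in> Hardy_inf"
  using bounded_subset[of "\<phi> ` cball 0 1" "\<phi> ` ball 0 1"]
    compact_imp_bounded[OF compact_continuous_image[of "cball 0 1" \<phi>]]
  by (auto simp: Hardy_inf_def disk_algebra_def image_mono)

lemma disk_algebra_mult: "disk_algebra \<phi> \<Longrightarrow> disk_algebra \<sigma> \<Longrightarrow> disk_algebra (\<lambda>z. \<phi> z * \<sigma> z)"
  by (simp add: disk_algebra_def continuous_on_mult holomorphic_on_mult)

lemma disk_algebra_power: "disk_algebra \<phi> \<Longrightarrow> disk_algebra (\<lambda>z. \<phi> z ^ n)"
  by (simp add: disk_algebra_def continuous_on_power holomorphic_on_power)

lemma disk_algebra_prod: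
  "(\<And>i. i \<in> I \<Longrightarrow> disk_algebra (\<phi> i)) \<Longrightarrow> disk_algebra (\<lambda>z. \<Prod>i\<in>I. \<phi> i z)"
  by (simp add: disk_algebra_def continuous_on_prod holomorphic_on_prod)

lemma disk_algebra_poly: "disk_algebra (poly p)"
  unfolding disk_algebra_def by (intro conjI continuous_intros holomorphic_intros)

lemma disk_algebra_linear: "disk_algebra (\<lambda>z. a + b * z)"
  unfolding disk_algebra_def by (intro conjI continuous_intros holomorphic_intros)

lemma disk_algebra_inverse_linear:
  assumes "cmod b < 1"
  shows "disk_algebra (\<lambda>z. 1 / (1 - b * z))"
proof -
  have "b * z \<noteq> 1" if "cmod z \<le> 1" for z
  proof
    assume "b * z = 1"
    then have "cmod b * cmod z = 1"
      by (metis norm_mult norm_one)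
    moreover have "cmod b * cmod z \<le> cmod b"
      using that by (simp add: mult_left_le)
    ultimately show False
      using assms by simp
  qed
  then show ?thesis
    unfolding disk_algebra_def by (intro conjI continuous_intros holomorphic_intros) auto
qed

lemma L2_fun_disk_algebra_mult:
  assumes "disk_algebra \<phi>" "L2_fun F"
  shows "L2_fun (\<lambda>z. \<phi> z * F z)"
proof -
  have [measurable]: "\<phi> \<in> borel_measurable circle"
    by (rule borel_measurable_circle_continuous)
      (use assms(1) in \<open>auto simp: disk_algebra_def intro: continuous_on_subset\<close>)
  have [measurable]: "F \<in> borel_measurable circle"
    using assms(2) by (simp add: L2_fun_def)
  obtain B where B: "\<And>z. cmod z \<le> 1 \<Longrightarrow> cmod (\<phi> z) \<le> B"
    using disk_algebra_bounded[OF assms(1)] by blast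
  have "integrable circle (\<lambda>z. (cmod (\<phi> z * F z))\<^sup>2)"
  proof (rule Bochner_Integration.integrable_bound[of _ "\<lambda>z. B\<^sup>2 * (cmod (F z))\<^sup>2"])
    show "AE z in circle. norm ((cmod (\<phi> z * F z))\<^sup>2) \<le> norm (B\<^sup>2 * (cmod (F z))\<^sup>2)"
      by (rule AE_I2) (auto simp: norm_mult power_mult_distrib intro!: mult_right_mono power_mono B)
  qed (use assms(2) in \<open>auto simp: L2_fun_def\<close>)
  then show ?thesis
    by (simp add: L2_fun_def)
qed

lemma L2_fun_const: "L2_fun (\<lambda>_. c)"
  using finite_measure_circle by (simp add: L2_fun_def finite_measure.integrable_const)

lemma L2_fun_disk_algebra: "disk_algebra \<phi> \<Longrightarrow> L2_fun \<phi>"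
  using L2_fun_disk_algebra_mult[OF _ L2_fun_const[of 1]] by simp

lemma Hardy_pair_disk: "Hardy_pair f F \<Longrightarrow> f \<in> Hardy2_disk"
  by (simp add: Hardy_pair_def)

lemma Hardy_pair_holomorphic: "Hardy_pair f F \<Longrightarrow> f holomorphic_on ball 0 1"
  by (simp add: Hardy_pair_def Hardy2_disk_def)

lemma Hardy_pair_L2: "Hardy_pair f F \<Longrightarrow> L2_fun F"
  by (simp add: Hardy_pair_def)

lemma Hardy_pair_add:
  assumes f: "Hardy_pair f F" and g: "Hardy_pair g G"
  shows "Hardy_pair (\<lambda>z. f z + g z) (\<lambda>z. F z + G z)"
proof -
  have "(cmod (f w + g w))\<^sup>2 \<le> 2 * (cmod (f w))\<^sup>2 + 2 * (cmod (g w))\<^sup>2 + 0" for w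
  proof -
    have "(cmod (f w + g w))\<^sup>2 \<le> (cmod (f w) + cmod (g w))\<^sup>2"
      by (intro power_mono norm_triangle_ineq) auto
    also have "\<dots> \<le> 2 * (cmod (f w))\<^sup>2 + 2 * (cmod (g w))\<^sup>2"
      using zero_le_power2[of "cmod (f w) - cmod (g w)"]
      by (simp add: power2_eq_square algebra_simps)
    finally show ?thesis by simp
  qed
  then have "(\<lambda>z. f z + g z) \<in> Hardy2_disk"
    by (intro Hardy2_disk_dominated[OF Hardy_pair_disk[OF f] Hardy_pair_disk[OF g], of _ 0 2 2 0]
        holomorphic_on_add Hardy_pair_holomorphic[OF f] Hardy_pair_holomorphic[OF g]) auto
  moreover have "AE z in circle. has_boundary_value (\<lambda>z. f z + g z) z (F z + G z)"
  proof -
    have "AE z in circle. has_boundary_value f z (F z)" "AE z in circle. has_boundary_value g z (G z)"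
      using f g by (auto simp: Hardy_pair_def)
    then show ?thesis
      by eventually_elim (auto simp: has_boundary_value_def intro!: tendsto_intros)
  qed
  ultimately show ?thesis
    using L2_fun_add[OF Hardy_pair_L2[OF f] Hardy_pair_L2[OF g]] by (simp add: Hardy_pair_def)
qed

lemma Hardy_pair_mult:
  assumes \<phi>: "disk_algebra \<phi>" and f: "Hardy_pair f F"
  shows "Hardy_pair (\<lambda>z. \<phi> z * f z) (\<lambda>z. \<phi> z * F z)"
proof -
  obtain B where B: "\<And>z. cmod z \<le> 1 \<Longrightarrow> cmod (\<phi> z) \<le> B"
    using disk_algebra_bounded[OF \<phi>] by blast
  have "(\<lambda>z. \<phi> z * f z) \<in> Hardy2_disk"
  proof (intro Hardy2_disk_dominated[OF Hardy_pair_disk[OF f] Hardy_pair_disk[OF f],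
        of _ 0 "B\<^sup>2" 0 0] holomorphic_on_mult Hardy_pair_holomorphic[OF f])
    show "\<phi> holomorphic_on ball 0 1"
      using \<phi> by (simp add: disk_algebra_def)
    fix w :: complex assume "cmod w < 1"
    then have "(cmod (\<phi> w))\<^sup>2 * (cmod (f w))\<^sup>2 \<le> B\<^sup>2 * (cmod (f w))\<^sup>2"
      by (intro mult_right_mono power_mono B) auto
    then show "(cmod (\<phi> w * f w))\<^sup>2 \<le> B\<^sup>2 * (cmod (f w))\<^sup>2 + 0 * (cmod (f w))\<^sup>2 + 0"
      by (simp add: norm_mult power_mult_distrib)
  qed auto
  moreover have "AE z in circle. has_boundary_value (\<lambda>z. \<phi> z * f z) z (\<phi> z * F z)"
  proof -
    have "AE z in circle. has_boundary_value f z (F z)"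
      using f by (simp add: Hardy_pair_def)
    moreover have "AE z in circle. has_boundary_value \<phi> z (\<phi> z)"
      by (rule AE_I2) (use disk_algebra_boundary_value[OF \<phi>] in auto)
    ultimately show ?thesis
      by eventually_elim (auto simp: has_boundary_value_def intro!: tendsto_intros)
  qed
  ultimately show ?thesis
    using L2_fun_disk_algebra_mult[OF \<phi> Hardy_pair_L2[OF f]] by (simp add: Hardy_pair_def)
qed

lemma Hardy_pair_const: "Hardy_pair (\<lambda>_. c) (\<lambda>_. c)"
proof -
  have "bdd_above ((\<lambda>r. LINT z|circle. (cmod c)\<^sup>2) ` {0..<1 :: real})"
    unfolding bdd_above_def by blast
  then show ?thesis
    unfolding Hardy_pair_def Hardy2_disk_def has_boundary_value_def
    by (intro conjI CollectI L2_fun_const) auto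
qed

lemma Hardy_pair_disk_algebra: "disk_algebra \<phi> \<Longrightarrow> Hardy_pair \<phi> \<phi>"
  using Hardy_pair_mult[OF _ Hardy_pair_const[of 1]] by simp

text \<open>On the circles of radius $r < 1$ this is the mean value property of holomorphic functions, and
  the $L^2$ bound allows the passage to the limit $r \to 1$. All later integral formulas follow from it by
  algebra.\<close>

lemma Hardy_pair_mean_value:
  assumes "Hardy_pair f F"
  shows "(LINT z|circle. F z) = f 0"
proof -
  interpret finite_measure circle by (rule finite_measure_circle)
  define r :: "nat \<Rightarrow> real" where "r n = 1 - 1 / (real n + 2)" for n
  have r: "0 \<le> r n" "r n < 1" for n
    by (auto simp: r_def)
  have hf: "f holomorphic_on ball 0 1"
    using assms by (simp add: Hardy_pair_def Hardy2_disk_def)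
  have rlim: "filterlim r (at_left 1) sequentially"
  proof (rule filterlim_at_withinI[OF _ always_eventually])
    show "r \<longlonglongrightarrow> 1"
      unfolding r_def by real_asymp
  qed (use r in \<open>auto simp: less_le\<close>)
  obtain C where C: "\<And>r. 0 \<le> r \<Longrightarrow> r < 1 \<Longrightarrow> (LINT z|circle. (cmod (f (complex_of_real r * z)))\<^sup>2) \<le> C"
    using assms unfolding Hardy_pair_def Hardy2_disk_def bdd_above_def by fastforce
  have "(\<lambda>n. LINT z|circle. f (complex_of_real (r n) * z)) \<longlonglongrightarrow> (LINT z|circle. F z)"
  proof (rule tendsto_integral_L2_bounded)
    have "AE z in circle. has_boundary_value f z (F z)"
      using assms by (simp add: Hardy_pair_def)
    then show "AE z in circle. (\<lambda>n. f (complex_of_real (r n) * z)) \<longlonglongrightarrow> F z"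
      by eventually_elim
        (auto simp: has_boundary_value_def intro: filterlim_compose[OF _ rlim])
    show "(LINT z|circle. (cmod (f (complex_of_real (r n) * z)))\<^sup>2) \<le> C" for n
      using C r by blast
  qed (use assms in \<open>auto simp: Hardy_pair_def L2_fun_def
      intro!: integrable_dilate_power2 borel_measurable_circle_continuous continuous_on_dilate hf r\<close>)
  moreover have "(\<lambda>n. LINT z|circle. f (complex_of_real (r n) * z)) = (\<lambda>n. f 0)"
    using mean_value_dilate[OF hf r] by blast
  ultimately show ?thesis
    using LIMSEQ_unique tendsto_const by metis
qed

text \<open>The difference quotient is holomorphic across \<open>a\<close>, and on an annulus
  next to the circle its denominator is bounded away from zero.\<close>

lemma Hardy_pair_difference_quotient:
  assumes f: "Hardy_pair f F" and a: "cmod a < 1"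
  shows "Hardy_pair (\<lambda>z. if z = a then deriv f a else (f z - f a) / (z - a)) (\<lambda>z. (F z - f a) / (z - a))"
    (is "Hardy_pair ?g ?G")
proof -
  have hf: "f holomorphic_on ball 0 1" and f2: "f \<in> Hardy2_disk"
    using f by (auto simp: Hardy_pair_def Hardy2_disk_def)
  have hg: "?g holomorphic_on ball 0 1"
    by (rule pole_lemma_open[OF hf]) simp
  \<comment> \<open>Any radius strictly between \<open>cmod a\<close> and 1 would do.\<close>
  define \<rho> where "\<rho> = (1 + cmod a) / 2"
  have \<rho>: "cmod a < \<rho>" "\<rho> < 1"
    using a by (auto simp: \<rho>_def)
  define d where "d = \<rho> - cmod a"
  have d: "d > 0"
    using \<rho> by (simp add: d_def)
  have "?g \<in> Hardy2_disk"
  proof (rule Hardy2_disk_dominated[OF f2 f2 hg \<rho>(2)])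
    fix w assume w: "\<rho> \<le> cmod w" "cmod w < 1"
    have "d \<le> cmod (w - a)"
      using w norm_triangle_ineq2[of w a] by (simp add: d_def)
    then have "d\<^sup>2 \<le> (cmod (w - a))\<^sup>2"
      using d by (intro power_mono) auto
    have "w \<noteq> a"
      using w \<rho> by auto
    have "(cmod (f w - f a))\<^sup>2 \<le> (cmod (f w) + cmod (f a))\<^sup>2"
      by (intro power_mono norm_triangle_ineq4) auto
    also have "\<dots> \<le> 2 * (cmod (f w))\<^sup>2 + 2 * (cmod (f a))\<^sup>2"
      using zero_le_power2[of "cmod (f w) - cmod (f a)"]
      by (simp add: power2_eq_square algebra_simps)
    finally have "(cmod (f w - f a))\<^sup>2 / (cmod (w - a))\<^sup>2 \<le> (2 * (cmod (f w))\<^sup>2 + 2 * (cmod (f a))\<^sup>2) / d\<^sup>2"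
      using \<open>d\<^sup>2 \<le> _\<close> d by (intro frac_le) auto
    then show "(cmod (?g w))\<^sup>2 \<le> (2 / d\<^sup>2) * (cmod (f w))\<^sup>2 + 0 * (cmod (f w))\<^sup>2 + 2 * (cmod (f a))\<^sup>2 / d\<^sup>2"
      using \<open>w \<noteq> a\<close> by (simp add: norm_divide power_divide add_divide_distrib)
  qed auto
  moreover have "AE z in circle. has_boundary_value ?g z (?G z)"
  proof -
    have "AE z in circle. has_boundary_value f z (F z)"
      using f by (simp add: Hardy_pair_def)
    moreover have "AE z in circle. z \<in> sphere 0 1"
      by (rule AE_I2) simp
    ultimately show ?thesis
    proof eventually_elim
      case (elim z)
      have za: "z \<noteq> a"
        using elim a by auto
      have "((\<lambda>r. (f (complex_of_real r * z) - f a) / (complex_of_real r * z - a)) \<longlongrightarrow>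
          (F z - f a) / (complex_of_real 1 * z - a)) (at_left 1)"
        using elim(1) za unfolding has_boundary_value_def by (intro tendsto_intros) auto
      moreover have "((\<lambda>r. complex_of_real r * z) \<longlongrightarrow> complex_of_real 1 * z) (at_left 1)"
        by (intro tendsto_intros)
      then have "eventually (\<lambda>r. complex_of_real r * z \<noteq> a) (at_left 1)"
        using za by (intro tendsto_imp_eventually_ne) auto
      ultimately show ?case
        unfolding has_boundary_value_def
        by (auto elim!: Lim_transform_eventually eventually_mono)
    qed
  qed
  moreover have "L2_fun ?G"
  proof -
    have F: "L2_fun F"
      using f by (simp add: Hardy_pair_def)
    have [measurable]: "F \<in> borel_measurable circle"
      using F by (simp add: L2_fun_def)
    have [measurable]: "(\<lambda>z. z) \<in> borel_measurable circle"
      by (rule borel_measurable_circle_continuous) (rule continuous_on_id)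
    have Fa: "L2_fun (\<lambda>z. F z - f a)"
      by (rule L2_fun_diff[OF F L2_fun_const])
    have "integrable circle (\<lambda>z. (cmod (?G z))\<^sup>2)"
    proof (rule Bochner_Integration.integrable_bound[of _ "\<lambda>z. (1 / d\<^sup>2) * (cmod (F z - f a))\<^sup>2"])
      have "(cmod (?G z))\<^sup>2 \<le> (1 / d\<^sup>2) * (cmod (F z - f a))\<^sup>2" if "z \<in> space circle" for z
      proof -
        have "d \<le> cmod (z - a)"
          using that \<rho> norm_triangle_ineq2[of z a] by (simp add: d_def)
        then have "d\<^sup>2 \<le> (cmod (z - a))\<^sup>2"
          using d by (intro power_mono) auto
        then have "(cmod (F z - f a))\<^sup>2 / (cmod (z - a))\<^sup>2 \<le> (cmod (F z - f a))\<^sup>2 / d\<^sup>2"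
          using d by (intro frac_le) auto
        then show ?thesis
          by (simp add: norm_divide power_divide)
      qed
      then show "AE z in circle. norm ((cmod (?G z))\<^sup>2) \<le> norm ((1 / d\<^sup>2) * (cmod (F z - f a))\<^sup>2)"
        by (intro AE_I2) auto
    qed (use Fa in \<open>auto simp: L2_fun_def\<close>)
    then show ?thesis
      by (auto simp: L2_fun_def)
  qed
  ultimately show ?thesis
    by (simp add: Hardy_pair_def)
qed

section \<open>Taylor coefficients as integrals over the circle\<close>

definition Hardy_boundary :: "(complex \<Rightarrow> complex) \<Rightarrow> bool"
  where "Hardy_boundary F \<longleftrightarrow> (\<exists>f. Hardy_pair f F)"

text \<open>Up to the factor $j!$ this is the $j$-th derivative with respect to $\bar a$ of the Szego
  kernel $1/(1 - \bar a z)$, so pairing with it yields the $j$-th Taylor coefficient at $a$. With this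
  normalization the off-diagonal entries of the Toeplitz operator become 1, as in a Jordan block.\<close>

definition kernel :: "complex \<Rightarrow> nat \<Rightarrow> complex \<Rightarrow> complex"
  where "kernel a j z = z ^ j / (1 - cnj a * z) ^ Suc j"

text \<open>For the boundary function of \<open>f\<close> in $H^2$ this is the \<open>j\<close>-th Taylor
  coefficient of \<open>f\<close> at \<open>a\<close>. It is handled through its reaction to multiplication by powers of
  \<open>z - a\<close>, as a formal coefficient extraction.\<close>

definition Taylor_functional :: "complex \<Rightarrow> nat \<Rightarrow> (complex \<Rightarrow> complex) \<Rightarrow> complex"
  where "Taylor_functional a j F = (LINT z|circle. F z * cnj (kernel a j z))"

lemma Hardy_boundary_L2: "Hardy_boundary F \<Longrightarrow> L2_fun F"
  by (auto simp: Hardy_boundary_def Hardy_pair_def)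

lemma Hardy_boundary_add:
  "Hardy_boundary F \<Longrightarrow> Hardy_boundary G \<Longrightarrow> Hardy_boundary (\<lambda>z. F z + G z)"
  unfolding Hardy_boundary_def using Hardy_pair_add by blast

lemma Hardy_boundary_mult:
  "disk_algebra \<phi> \<Longrightarrow> Hardy_boundary F \<Longrightarrow> Hardy_boundary (\<lambda>z. \<phi> z * F z)"
  unfolding Hardy_boundary_def using Hardy_pair_mult by blast

lemma Hardy_boundary_disk_algebra: "disk_algebra \<phi> \<Longrightarrow> Hardy_boundary \<phi>"
  unfolding Hardy_boundary_def using Hardy_pair_disk_algebra by blast

lemma Hardy_boundary_AE_cong:
  assumes "Hardy_boundary F" "L2_fun G" "AE z in circle. F z = G z"
  shows "Hardy_boundary G"
proof -
  obtain f where f: "Hardy_pair f F"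
    using assms(1) by (auto simp: Hardy_boundary_def)
  then have "AE z in circle. has_boundary_value f z (F z)"
    by (simp add: Hardy_pair_def)
  with assms(3) have "AE z in circle. has_boundary_value f z (G z)"
    by eventually_elim simp
  then show ?thesis
    using f assms(2) by (auto simp: Hardy_boundary_def Hardy_pair_def)
qed

lemma L2_fun_cong_circle:
  assumes "\<And>z. cmod z = 1 \<Longrightarrow> F z = G z"
  shows "L2_fun F \<longleftrightarrow> L2_fun G"
proof -
  have "F \<in> borel_measurable circle \<longleftrightarrow> G \<in> borel_measurable circle"
    by (rule measurable_cong) (use assms in auto)
  moreover have "integrable circle (\<lambda>z. (cmod (F z))\<^sup>2) \<longleftrightarrow> integrable circle (\<lambda>z. (cmod (G z))\<^sup>2)"
    by (rule Bochner_Integration.integrable_cong) (use assms in auto)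
  ultimately show ?thesis
    by (simp add: L2_fun_def)
qed

lemma Hardy_boundary_cong:
  assumes "Hardy_boundary F" "\<And>z. cmod z = 1 \<Longrightarrow> F z = G z"
  shows "Hardy_boundary G"
  by (rule Hardy_boundary_AE_cong[OF assms(1)])
    (use assms L2_fun_cong_circle[of F G] Hardy_boundary_L2 in \<open>auto intro!: AE_I2\<close>)

lemma integral_circle_cong:
  assumes "\<And>z. cmod z = 1 \<Longrightarrow> F z = G z"
  shows "(LINT z|circle. F z) = (LINT z|circle. G z)"
  by (rule Bochner_Integration.integral_cong) (use assms in auto)

text \<open>The function \<open>z f\<close> vanishes at the origin.\<close>

lemma integral_mult_id_Hardy_boundary:
  assumes "Hardy_boundary F"
  shows "(LINT z|circle. z * F z) = 0"
proof -
  obtain f where f: "Hardy_pair f F"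
    using assms by (auto simp: Hardy_boundary_def)
  have "disk_algebra (\<lambda>z. z)"
    using disk_algebra_linear[of 0 1] by simp
  from Hardy_pair_mean_value[OF Hardy_pair_mult[OF this f]] show ?thesis
    by simp
qed

lemma cnj_inverse_linear_circle:
  assumes "cmod z = 1"
  shows "cnj (1 / (1 - cnj a * z)) = z / (z - a)"
proof -
  have "z * cnj z = 1"
    using assms by (simp add: complex_norm_square[symmetric])
  then have "z - a = z * (1 - a * cnj z)"
    by (simp add: algebra_simps)
  moreover have "z \<noteq> 0"
    using assms by auto
  ultimately show ?thesis
    by simp
qed

text \<open>On the circle $\bar z = 1/z$, which turns the conjugate kernel into the Cauchy kernel.\<close>

lemma cnj_kernel_circle:
  assumes "cmod z = 1"
  shows "cnj (kernel a j z) = z / (z - a) ^ Suc j"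
proof -
  have "z * cnj z = 1"
    using assms by (simp add: complex_norm_square[symmetric])
  have "kernel a j z = z ^ j * (1 / (1 - cnj a * z)) ^ Suc j"
    by (simp add: kernel_def power_divide)
  then have "cnj (kernel a j z) = cnj z ^ j * (z / (z - a)) ^ Suc j"
    by (simp only: complex_cnj_mult complex_cnj_power cnj_inverse_linear_circle[OF assms])
  also have "\<dots> = (z * cnj z) ^ j * (z / (z - a) ^ Suc j)"
    by (simp add: power_divide power_mult_distrib)
  finally show ?thesis
    using \<open>z * cnj z = 1\<close> by simp
qed

lemma disk_algebra_kernel:
  assumes "cmod a < 1"
  shows "disk_algebra (kernel a j)"
proof -
  have "disk_algebra (\<lambda>z. (0 + 1 * z) ^ j * (1 / (1 - cnj a * z)) ^ Suc j)"
    by (intro disk_algebra_mult disk_algebra_power disk_algebra_linear disk_algebra_inverse_linear)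
      (use assms in auto)
  then show ?thesis
    by (simp add: kernel_def[abs_def] power_divide)
qed

lemma Taylor_functional_eq:
  "Taylor_functional a j F = (LINT z|circle. F z * (z / (z - a) ^ Suc j))"
  unfolding Taylor_functional_def by (rule integral_circle_cong) (simp add: cnj_kernel_circle)

lemma Taylor_functional_cong:
  "(\<And>z. cmod z = 1 \<Longrightarrow> F z = G z) \<Longrightarrow> Taylor_functional a j F = Taylor_functional a j G"
  unfolding Taylor_functional_def by (rule integral_circle_cong) simp

lemma Taylor_functional_add:
  assumes "cmod a < 1" "L2_fun F" "L2_fun G"
  shows "Taylor_functional a j (\<lambda>z. F z + G z) = Taylor_functional a j F + Taylor_functional a j G"
  unfolding Taylor_functional_def
  using L2_fun_integrable_mult_cnj[OF _ L2_fun_disk_algebra[OF disk_algebra_kernel[OF assms(1)]]] assms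
  by (simp add: distrib_right)

lemma Taylor_functional_scale:
  "Taylor_functional a j (\<lambda>z. c * F z) = c * Taylor_functional a j F"
  unfolding Taylor_functional_def by (simp add: mult.assoc)

lemma Taylor_functional_linear_mult:
  assumes "cmod a < 1"
  shows "Taylor_functional a (Suc j) (\<lambda>z. (z - a) * F z) = Taylor_functional a j F"
  unfolding Taylor_functional_eq
proof (rule integral_circle_cong)
  fix z :: complex assume "cmod z = 1"
  then have "z - a \<noteq> 0"
    using assms by auto
  then show "(z - a) * F z * (z / (z - a) ^ Suc (Suc j)) = F z * (z / (z - a) ^ Suc j)"
    by simp
qed

lemma disk_algebra_minus: "disk_algebra (\<lambda>z. z - a)"
  using disk_algebra_linear[of "- a" 1] by simp

text \<open>A zero of order \<open>n\<close> cancels the pole of the Cauchy kernel, and what remains is \<open>z\<close> times a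
  function in $H^2$.\<close>

lemma Taylor_functional_power_mult:
  assumes "cmod a < 1" "Hardy_boundary F" "j < n"
  shows "Taylor_functional a j (\<lambda>z. (z - a) ^ n * F z) = 0"
proof -
  have "Taylor_functional a j (\<lambda>z. (z - a) ^ n * F z) =
      (LINT z|circle. z * ((z - a) ^ (n - Suc j) * F z))"
    unfolding Taylor_functional_eq
  proof (rule integral_circle_cong)
    fix z :: complex assume "cmod z = 1"
    then have "z - a \<noteq> 0"
      using assms by auto
    moreover have "(z - a) ^ n = (z - a) ^ (n - Suc j) * (z - a) ^ Suc j"
      by (metis Suc_leI assms(3) le_add_diff_inverse2 power_add)
    ultimately show "(z - a) ^ n * F z * (z / (z - a) ^ Suc j) = z * ((z - a) ^ (n - Suc j) * F z)"
      by (simp del: power_Suc)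
  qed
  also have "\<dots> = 0"
    by (intro integral_mult_id_Hardy_boundary Hardy_boundary_mult disk_algebra_power
        disk_algebra_minus assms)
  finally show ?thesis .
qed

text \<open>The integral is the conjugate of the mean value of the kernel, which is its value at the origin.\<close>

lemma Taylor_functional_1:
  assumes "cmod a < 1"
  shows "Taylor_functional a j (\<lambda>_. 1) = (if j = 0 then 1 else 0)"
proof -
  have "Taylor_functional a j (\<lambda>_. 1) = cnj (LINT z|circle. kernel a j z)"
    by (simp add: Taylor_functional_def)
  also have "(LINT z|circle. kernel a j z) = kernel a j 0"
    by (intro Hardy_pair_mean_value Hardy_pair_disk_algebra disk_algebra_kernel assms)
  finally show ?thesis
    by (simp add: kernel_def)
qed

lemma Taylor_functional_power:
  assumes "cmod a < 1"
  shows "Taylor_functional a j (\<lambda>z. (z - a) ^ l) = (if j = l then 1 else 0)"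
proof (cases "j < l")
  case True
  have "Hardy_boundary (\<lambda>_. 1)"
    using Hardy_pair_const by (auto simp: Hardy_boundary_def)
  from Taylor_functional_power_mult[OF assms this True] True show ?thesis
    by simp
next
  case False
  have "Taylor_functional a (l + k) (\<lambda>z. (z - a) ^ l) = Taylor_functional a k (\<lambda>_. 1)" for k
    by (induction l) (simp_all add: Taylor_functional_linear_mult[OF assms])
  from this[of "j - l"] False show ?thesis
    by (auto simp: Taylor_functional_1[OF assms])
qed

text \<open>Subtracting \<open>f a\<close> always makes the quotient belong to $H^2$; comparing coefficients at \<open>a\<close>
  then shows that \<open>f a\<close> is the given functional, hence zero.\<close>

lemma Hardy_boundary_divide_linear:
  assumes F: "Hardy_boundary F" and a: "cmod a < 1" and zero: "Taylor_functional a 0 F = 0"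
  shows "Hardy_boundary (\<lambda>z. F z / (z - a))"
proof -
  obtain f where f: "Hardy_pair f F"
    using F by (auto simp: Hardy_boundary_def)
  define G where "G = (\<lambda>z. (F z - f a) / (z - a))"
  have G: "Hardy_boundary G"
    using Hardy_pair_difference_quotient[OF f a] by (auto simp: Hardy_boundary_def G_def)
  have eq: "F z = (z - a) * G z + f a * 1" if "cmod z = 1" for z
    using that a by (auto simp: G_def)
  have "Hardy_boundary (\<lambda>z. (z - a) * G z)"
    by (intro Hardy_boundary_mult disk_algebra_minus G)
  then have "Taylor_functional a 0 F = Taylor_functional a 0 (\<lambda>z. (z - a) * G z) + Taylor_functional a 0 (\<lambda>z. f a * 1)"
    using Taylor_functional_cong[OF eq] Taylor_functional_add[OF a Hardy_boundary_L2 L2_fun_const[of "f a"]]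
    by simp
  moreover have "Taylor_functional a 0 (\<lambda>z. (z - a) * G z) = 0"
    using Taylor_functional_power_mult[OF a G, of 0 1] by simp
  moreover have "Taylor_functional a 0 (\<lambda>z. f a * 1) = f a"
    unfolding Taylor_functional_scale Taylor_functional_1[OF a] by simp
  ultimately have "f a = 0"
    using zero by simp
  then show ?thesis
    using G by (simp add: G_def)
qed

lemma Hardy_boundary_divide_power:
  assumes "Hardy_boundary F" and a: "cmod a < 1" and "\<And>j. j < n \<Longrightarrow> Taylor_functional a j F = 0"
  shows "Hardy_boundary (\<lambda>z. F z / (z - a) ^ n)"
  using assms(1,3)
proof (induction n arbitrary: F)
  case 0
  then show ?case by simp
next
  case (Suc n)
  have G: "Hardy_boundary (\<lambda>z. F z / (z - a))"
    using Suc.prems by (intro Hardy_boundary_divide_linear a) auto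
  have "Taylor_functional a j (\<lambda>z. F z / (z - a)) = 0" if "j < n" for j
  proof -
    have "Taylor_functional a j (\<lambda>z. F z / (z - a)) =
        Taylor_functional a (Suc j) (\<lambda>z. (z - a) * (F z / (z - a)))"
      by (rule Taylor_functional_linear_mult[OF a, symmetric])
    also have "\<dots> = Taylor_functional a (Suc j) F"
      by (rule Taylor_functional_cong) (use a in auto)
    finally show ?thesis
      using Suc.prems(2)[of "Suc j"] that by simp
  qed
  from Suc.IH[OF G this] show ?case
    by simp
qed

section \<open>Division by polynomials in the Hardy space\<close>

lemma coprime_linear_poly_powers:
  fixes a b :: complex
  assumes "a \<noteq> b"
  shows "coprime ([:- a, 1:] ^ m) ([:- b, 1:] ^ n)"
proof -
  have "coprime [:- a, 1:] [:- b, 1:]"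
  proof (rule coprimeI)
    fix d assume "d dvd [:- a, 1:]" "d dvd [:- b, 1:]"
    then have "d dvd [:- a, 1:] - [:- b, 1:]"
      by (rule dvd_diff)
    also have "[:- a, 1:] - [:- b, 1:] = [:b - a:]"
      by simp
    also have "[:b - a:] dvd 1"
      using assms by (simp add: is_unit_const_poly_iff dvd_field_iff)
    finally show "is_unit d" .
  qed
  then show ?thesis
    by simp
qed

text \<open>The induction corrects a solution for \<open>I\<close> by a multiple of the product of its moduli, using
  a Bezout identity. The lemma is used both to prescribe the symbol on the jets at the zeros of the
  Blaschke product and to construct polynomials dual to the kernels.\<close>

lemma chinese_remainder_poly:
  fixes q r :: "'i \<Rightarrow> complex poly"
  assumes "finite I" "\<And>i j. i \<in> I \<Longrightarrow> j \<in> I \<Longrightarrow> i \<noteq> j \<Longrightarrow> coprime (q i) (q j)"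
  shows "\<exists>p. \<forall>i\<in>I. q i dvd p - r i"
  using assms
proof (induction I)
  case empty
  then show ?case by simp
next
  case (insert k I)
  then obtain p where p: "\<And>i. i \<in> I \<Longrightarrow> q i dvd p - r i"
    by auto
  define Q where "Q = (\<Prod>i\<in>I. q i)"
  have "coprime (q k) Q"
    unfolding Q_def using insert by (intro prod_coprime_right) auto
  then obtain u v where uv: "u * q k + v * Q = 1"
    using bezout_coefficients_fst_snd[of "q k" Q] by (auto simp: coprime_iff_gcd_eq_1)
  define p' where "p' = p + v * Q * (r k - p)"
  have "p' - r k = (p - r k) * (1 - v * Q)"
    by (simp add: p'_def algebra_simps)
  also have "1 - v * Q = u * q k"
    using uv by (simp add: algebra_simps)
  finally have "q k dvd p' - r k"
    by simp
  moreover have "q i dvd p' - r i" if "i \<in> I" for i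
  proof -
    have "q i dvd Q"
      unfolding Q_def using insert that by (intro dvd_prodI) auto
    then have "q i dvd (p - r i) + v * Q * (r k - p)"
      by (intro dvd_add p that) auto
    then show ?thesis
      by (simp add: p'_def algebra_simps)
  qed
  ultimately show ?case
    by blast
qed

text \<open>If \<open>u p + v q = 1\<close> then \<open>F / (p q) = u F / q + v F / p\<close>. This combines divisions at different
  points without any local analysis at the zeros.\<close>

lemma Hardy_boundary_divide_coprime:
  assumes "coprime p q" and nz: "\<And>z. cmod z = 1 \<Longrightarrow> poly p z \<noteq> 0" "\<And>z. cmod z = 1 \<Longrightarrow> poly q z \<noteq> 0"
    and p: "Hardy_boundary (\<lambda>z. F z / poly p z)" and q: "Hardy_boundary (\<lambda>z. F z / poly q z)"
  shows "Hardy_boundary (\<lambda>z. F z / poly (p * q) z)"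
proof -
  obtain u v where uv: "u * p + v * q = 1"
    using assms(1) bezout_coefficients_fst_snd[of p q] by (auto simp: coprime_iff_gcd_eq_1)
  have "Hardy_boundary (\<lambda>z. poly u z * (F z / poly q z) + poly v z * (F z / poly p z))"
    by (intro Hardy_boundary_add Hardy_boundary_mult disk_algebra_poly p q)
  then show ?thesis
  proof (rule Hardy_boundary_cong)
    fix z :: complex assume z: "cmod z = 1"
    have "poly u z * poly p z + poly v z * poly q z = poly (u * p + v * q) z"
      by simp
    also have "\<dots> = 1"
      by (simp add: uv)
    finally have "F z = (poly u z * poly p z + poly v z * poly q z) * F z"
      by simp
    then show "poly u z * (F z / poly q z) + poly v z * (F z / poly p z) = F z / poly (p * q) z"
      using nz[OF z] by (simp add: field_simps)
  qed
qed

lemma Hardy_boundary_divide_prod: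
  assumes "finite I" "inj_on a I" "\<And>i. i \<in> I \<Longrightarrow> cmod (a i) < 1" "Hardy_boundary F"
    and "\<And>i j. i \<in> I \<Longrightarrow> j < n i \<Longrightarrow> Taylor_functional (a i) j F = 0"
  shows "Hardy_boundary (\<lambda>z. F z / poly (\<Prod>i\<in>I. [:- a i, 1:] ^ n i) z)"
  using assms
proof (induction I)
  case empty
  then show ?case by simp
next
  case (insert k I)
  have IH: "Hardy_boundary (\<lambda>z. F z / poly (\<Prod>i\<in>I. [:- a i, 1:] ^ n i) z)"
    using insert by auto
  have k: "Hardy_boundary (\<lambda>z. F z / poly ([:- a k, 1:] ^ n k) z)"
    using Hardy_boundary_divide_power[of F "a k" "n k"] insert.prems by (simp add: poly_power)
  have "coprime ([:- a k, 1:] ^ n k) (\<Prod>i\<in>I. [:- a i, 1:] ^ n i)"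
    using insert by (intro prod_coprime_right coprime_linear_poly_powers) auto
  from Hardy_boundary_divide_coprime[OF this _ _ k IH] show ?case
    using insert by (force simp: poly_prod poly_power)
qed

section \<open>Orthogonal projection in complex inner product spaces\<close>

interpretation complex_vector: vector_space "scaleC :: complex \<Rightarrow> 'a \<Rightarrow> 'a::complex_vector"
  by (rule vector_space_scaleC)

lemma cinner_add_right: "cinner x (y + z) = cinner x y + cinner x (z :: 'a::complex_inner)"
  by (subst (1 2 3) cinner_commute) (simp add: cinner_add_left)

lemma cinner_scaleC_right: "cinner x (c *\<^sub>C y) = cnj c * cinner x (y :: 'a::complex_inner)"
  by (subst (1 2) cinner_commute) (simp add: cinner_scaleC_left)

lemma cinner_zero_left: "cinner 0 (y :: 'a::complex_inner) = 0"
  using cinner_add_left[of 0 0 y] by simp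

lemma cinner_zero_right: "cinner (x :: 'a::complex_inner) 0 = 0"
  using cinner_add_right[of x 0 0] by simp

lemma cinner_diff_left: "cinner (x - y) z = cinner x z - cinner y (z :: 'a::complex_inner)"
  using cinner_add_left[of "x - y" y z] by simp

lemma cinner_eq_zero_iff: "cinner x x = 0 \<longleftrightarrow> x = (0 :: 'a::complex_inner)"
  using inner_eq_zero_iff[of x] cinner_zero_left by (auto simp: inner_eq_Re_cinner)

lemma cinner_sum_right: "cinner u (\<Sum>x\<in>A. v x) = (\<Sum>x\<in>A. cinner (u :: 'a::complex_inner) (v x))"
  by (induction A rule: infinite_finite_induct) (simp_all add: cinner_zero_right cinner_add_right)

lemma cinner_zero_span:
  fixes u :: "'a::complex_inner"
  assumes "\<And>z. z \<in> S \<Longrightarrow> cinner u z = 0" "z \<in> complex_vector.span S"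
  shows "cinner u z = 0"
proof -
  have "complex_vector.subspace {z. cinner u z = 0}"
    by (rule complex_vector.subspaceI)
      (auto simp: cinner_zero_right cinner_add_right cinner_scaleC_right)
  from complex_vector.span_minimal[OF _ this, of S] assms show ?thesis
    by blast
qed

text \<open>Gram-Schmidt: the part \<open>w\<close> of the new vector that is orthogonal to the span of the old ones
  supplies the correction of the old projection.\<close>

lemma orthogonal_projection_on_span:
  fixes x :: "'a::complex_inner"
  assumes "finite S"
  shows "\<exists>y\<in>complex_vector.span S. \<forall>z\<in>S. cinner (x - y) z = 0"
  using assms
proof (induction S arbitrary: x)
  case empty
  show ?case
    by (auto intro!: bexI[of _ 0] simp: complex_vector.span_zero)
next
  case (insert v S)
  obtain y where y: "y \<in> complex_vector.span S" "\<And>z. z \<in> S \<Longrightarrow> cinner (x - y) z = 0"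
    using insert.IH by blast
  obtain p where p: "p \<in> complex_vector.span S" "\<And>z. z \<in> S \<Longrightarrow> cinner (v - p) z = 0"
    using insert.IH by blast
  define w where "w = v - p"
  have mono: "complex_vector.span S \<subseteq> complex_vector.span (insert v S)"
    by (intro complex_vector.span_mono) auto
  have w_span: "w \<in> complex_vector.span (insert v S)"
    unfolding w_def using p(1) mono
    by (intro complex_vector.span_diff) (auto intro: complex_vector.span_base)
  define c where "c = cinner (x - y) w / cinner w w"
  have cw: "cinner (x - y) w = c * cinner w w"
    by (cases "w = 0") (auto simp: c_def cinner_eq_zero_iff cinner_zero_right)
  define y' where "y' = y + c *\<^sub>C w"
  have y': "x - y' = (x - y) - c *\<^sub>C w"
    by (simp add: y'_def)
  have orthS: "cinner (x - y') z = 0" if "z \<in> S" for z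
    using y(2)[OF that] p(2)[OF that]
    by (simp add: y' cinner_diff_left cinner_scaleC_left flip: w_def)
  have "cinner (x - y') w = 0"
    using cw by (simp add: y' cinner_diff_left[of "x - y"] cinner_scaleC_left)
  moreover have "cinner (x - y') p = 0"
    by (rule cinner_zero_span[OF orthS p(1)])
  moreover have "v = w + p"
    by (simp add: w_def)
  ultimately have "cinner (x - y') v = 0"
    by (simp only: cinner_add_right) simp
  moreover have "y' \<in> complex_vector.span (insert v S)"
    unfolding y'_def using y(1) mono w_span
    by (intro complex_vector.span_add complex_vector.span_scale) auto
  ultimately show ?case
    using orthS by blast
qed

lemma orth_proj_eqI:
  assumes M: "complex_vector.subspace M" and y: "y \<in> M" "\<And>z. z \<in> M \<Longrightarrow> cinner (x - y) z = 0"
  shows "orth_proj M x = y"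
  unfolding orth_proj_def
proof (rule the_equality)
  fix y' assume y': "y' \<in> M \<and> (\<forall>z\<in>M. cinner (x - y') z = 0)"
  have "y - y' \<in> M"
    using M y(1) y' by (intro complex_vector.subspace_diff) auto
  then have "cinner (x - y') (y - y') = 0" "cinner (x - y) (y - y') = 0"
    using y y' by auto
  then have "cinner (y - y') (y - y') = 0"
    using cinner_diff_left[of "x - y'" "x - y" "y - y'"] by simp
  then show "y' = y"
    by (simp add: cinner_eq_zero_iff)
qed (use y in blast)

section \<open>Square integrable classes and the model space\<close>

lemma L2_eq_rep: "L2_eq (rep_circle_L2 F) (rep_circle_L2 F)"
  by (rule Quotient3_rep_reflp[OF Quotient3_circle_L2])

lemma L2_fun_rep: "L2_fun (rep_circle_L2 F)"
  using L2_eq_rep by (simp add: L2_eq_def)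

lemma abs_rep: "abs_circle_L2 (rep_circle_L2 F) = F"
  by (rule Quotient3_abs_rep[OF Quotient3_circle_L2])

lemma abs_eqI: "L2_eq f g \<Longrightarrow> abs_circle_L2 f = abs_circle_L2 g"
  by (rule Quotient3_rel_abs[OF Quotient3_circle_L2])

lemma AE_rep_abs:
  assumes "L2_fun f"
  shows "AE z in circle. f z = rep_circle_L2 (abs_circle_L2 f) z"
proof -
  have "L2_eq f f"
    using assms by (simp add: L2_eq_def)
  from Quotient3_rep_abs[OF Quotient3_circle_L2, OF this] show ?thesis
    by (auto simp: L2_eq_def)
qed

lemma L2_eqI_circle:
  assumes "L2_fun f" "\<And>z. cmod z = 1 \<Longrightarrow> f z = g z"
  shows "L2_eq f g"
  using assms L2_fun_cong_circle[of f g] by (auto simp: L2_eq_def intro!: AE_I2)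

lemma cinner_abs:
  "L2_fun f \<Longrightarrow> L2_fun g \<Longrightarrow> cinner (abs_circle_L2 f) (abs_circle_L2 g) = (LINT z|circle. f z * cnj (g z))"
  by (rule cinner_circle_L2.abs_eq) (auto simp: L2_eq_def)

lemma plus_abs:
  "L2_fun f \<Longrightarrow> L2_fun g \<Longrightarrow> abs_circle_L2 f + abs_circle_L2 g = abs_circle_L2 (\<lambda>z. f z + g z)"
  by (rule plus_circle_L2.abs_eq) (auto simp: L2_eq_def)

lemma scaleC_abs:
  "L2_fun f \<Longrightarrow> c *\<^sub>C abs_circle_L2 f = abs_circle_L2 (\<lambda>z. c * f z)"
  by (rule scaleC_circle_L2.abs_eq) (auto simp: L2_eq_def)

text \<open>The multiplier \<open>\<phi>'\<close> will be a boundary function, which is known only on the circle.\<close>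

lemma L2_mult_eq_abs:
  assumes "disk_algebra \<phi>" "\<And>z. cmod z = 1 \<Longrightarrow> \<phi>' z = \<phi> z" "L2_fun f"
  shows "L2_mult \<phi>' (abs_circle_L2 f) = abs_circle_L2 (\<lambda>z. \<phi> z * f z)"
  unfolding L2_mult_def
proof (rule abs_eqI)
  have L2: "L2_fun (\<lambda>z. \<phi> z * rep_circle_L2 (abs_circle_L2 f) z)"
    by (intro L2_fun_disk_algebra_mult assms L2_fun_rep)
  have "AE z in circle. z \<in> sphere 0 1"
    by (rule AE_I2) simp
  with AE_rep_abs[OF assms(3)]
  have "AE z in circle. \<phi>' z * rep_circle_L2 (abs_circle_L2 f) z = \<phi> z * f z"
    by eventually_elim (use assms(2) in auto)
  moreover have "L2_fun (\<lambda>z. \<phi>' z * rep_circle_L2 (abs_circle_L2 f) z)"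
    using L2 by (rule L2_fun_cong_circle[THEN iffD1, rotated]) (simp add: assms(2))
  ultimately show "L2_eq (\<lambda>z. \<phi>' z * rep_circle_L2 (abs_circle_L2 f) z) (\<lambda>z. \<phi> z * f z)"
    by (simp add: L2_eq_def L2_fun_disk_algebra_mult assms)
qed

text \<open>Multiplication by a conjugate symbol is the adjoint of multiplication by the symbol. This moves
  the co-analytic symbol to the analytic side, where it preserves $H^2$.\<close>

lemma cinner_L2_mult_cnj:
  assumes \<phi>: "disk_algebra \<phi>" "\<And>z. cmod z = 1 \<Longrightarrow> \<phi>' z = cnj (\<phi> z)" and f: "L2_fun f" and g: "L2_fun g"
  shows "cinner (L2_mult \<phi>' (abs_circle_L2 f)) (abs_circle_L2 g) =
    cinner (abs_circle_L2 f) (abs_circle_L2 (\<lambda>z. \<phi> z * g z))"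
proof -
  have cnj_L2: "L2_fun (\<lambda>z. cnj (h z)) \<longleftrightarrow> L2_fun h" for h
  proof -
    have "(\<lambda>z. cnj (h z)) \<in> borel_measurable circle \<longleftrightarrow> h \<in> borel_measurable circle"
      using borel_measurable_cnj[of h circle] borel_measurable_cnj[of "\<lambda>z. cnj (h z)" circle]
      unfolding complex_cnj_cnj by blast
    then show ?thesis
      unfolding L2_fun_def complex_mod_cnj by blast
  qed
  define r where "r = rep_circle_L2 (abs_circle_L2 f)"
  have r: "L2_fun r"
    by (simp add: r_def L2_fun_rep)
  have "L2_fun (\<lambda>z. \<phi> z * cnj (r z))"
    by (intro L2_fun_disk_algebra_mult \<phi>) (simp add: cnj_L2 r)
  then have "L2_fun (\<lambda>z. cnj (\<phi> z * cnj (r z)))"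
    by (simp only: cnj_L2)
  then have "L2_fun (\<lambda>z. \<phi>' z * r z)"
    by (rule L2_fun_cong_circle[THEN iffD1, rotated]) (simp add: \<phi>(2))
  then have "cinner (L2_mult \<phi>' (abs_circle_L2 f)) (abs_circle_L2 g) = (LINT z|circle. \<phi>' z * r z * cnj (g z))"
    unfolding L2_mult_def by (simp only: cinner_abs g flip: r_def)
  also have "\<dots> = (LINT z|circle. r z * cnj (\<phi> z * g z))"
    by (rule integral_circle_cong) (simp add: \<phi>(2))
  also have "\<dots> = cinner (abs_circle_L2 r) (abs_circle_L2 (\<lambda>z. \<phi> z * g z))"
    by (intro cinner_abs[symmetric] r L2_fun_disk_algebra_mult \<phi> g)
  also have "abs_circle_L2 r = abs_circle_L2 f"
    by (simp add: r_def abs_rep)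
  finally show ?thesis .
qed

lemma Hardy2_iff: "F \<in> Hardy2 \<longleftrightarrow> Hardy_boundary (rep_circle_L2 F)"
  by (auto simp: Hardy2_def Hardy_boundary_def Hardy_pair_def L2_fun_rep)

lemma abs_in_Hardy2: "Hardy_boundary f \<Longrightarrow> abs_circle_L2 f \<in> Hardy2"
  unfolding Hardy2_iff
  by (rule Hardy_boundary_AE_cong[OF _ L2_fun_rep AE_rep_abs]) (auto intro: Hardy_boundary_L2)

lemma Hardy2E:
  assumes "F \<in> Hardy2"
  obtains f where "Hardy_boundary f" "F = abs_circle_L2 f"
  using assms unfolding Hardy2_iff by (metis abs_rep)

lemma subspace_Hardy2: "complex_vector.subspace Hardy2"
proof (rule complex_vector.subspaceI)
  have 0: "Hardy_boundary (\<lambda>_. 0)"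
    using Hardy_pair_const by (auto simp: Hardy_boundary_def)
  then show "0 \<in> Hardy2"
    using abs_in_Hardy2[OF 0] by (simp add: zero_circle_L2.abs_eq)
next
  fix F G assume "F \<in> Hardy2" "G \<in> Hardy2"
  then show "F + G \<in> Hardy2"
    by (elim Hardy2E) (simp add: plus_abs Hardy_boundary_L2 abs_in_Hardy2 Hardy_boundary_add)
next
  fix c F assume "F \<in> Hardy2"
  moreover have "disk_algebra (\<lambda>_. c)"
    using disk_algebra_linear[of c 0] by simp
  ultimately show "c *\<^sub>C F \<in> Hardy2"
    by (elim Hardy2E) (simp add: scaleC_abs Hardy_boundary_L2 abs_in_Hardy2 Hardy_boundary_mult)
qed

lemma model_space_iff:
  assumes \<Theta>: "disk_algebra \<Theta>"
  shows "F \<in> model_space \<Theta> \<longleftrightarrow>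
    F \<in> Hardy2 \<and> (\<forall>h. Hardy_boundary h \<longrightarrow> cinner F (abs_circle_L2 (\<lambda>z. \<Theta> z * h z)) = 0)"
proof -
  have "L2_mult (boundary \<Theta>) ` Hardy2 = (\<lambda>h. abs_circle_L2 (\<lambda>z. \<Theta> z * h z)) ` {h. Hardy_boundary h}"
    (is "?A = ?B")
  proof -
    have eq: "L2_mult (boundary \<Theta>) (abs_circle_L2 h) = abs_circle_L2 (\<lambda>z. \<Theta> z * h z)" if "Hardy_boundary h" for h
      using that by (intro L2_mult_eq_abs \<Theta> boundary_disk_algebra Hardy_boundary_L2)
    show ?thesis
    proof
      show "?A \<subseteq> ?B"
        by (force elim: Hardy2E simp: eq)
      show "?B \<subseteq> ?A"
        using eq abs_in_Hardy2 by force
    qed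
  qed
  then show ?thesis
    unfolding model_space_def by auto
qed

lemma subspace_model_space: "complex_vector.subspace (model_space \<Theta>)"
  using subspace_Hardy2 unfolding model_space_def complex_vector.subspace_def
  by (auto simp: cinner_zero_left cinner_add_left cinner_scaleC_left)

section \<open>Jordan bases\<close>

definition block_offset :: "(nat \<times> 'a) list \<Rightarrow> nat \<Rightarrow> nat"
  where "block_offset n_as i = sum_list (map fst (take i n_as))"

text \<open>The bridge from the single index of the block matrix to the double index (block, position) of a
  Jordan basis.\<close>

lemma jordan_matrix_column:
  fixes n_as :: "(nat \<times> 'a::{zero,one}) list"
  assumes "i < length n_as" "j < fst (n_as ! i)" "r < sum_list (map fst n_as)"
  shows "block_offset n_as i + j < sum_list (map fst n_as) \<and>
    jordan_matrix n_as $$ (r, block_offset n_as i + j) =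
      (if r = block_offset n_as i + j then snd (n_as ! i)
       else if j \<noteq> 0 \<and> Suc r = block_offset n_as i + j then 1 else 0)"
  using assms
proof (induction n_as arbitrary: i r)
  case Nil
  then show ?case by simp
next
  case (Cons x n_as)
  obtain m a where x: "x = (m, a)"
    by (cases x)
  have J: "jordan_matrix (x # n_as) = four_block_mat (jordan_block m a)
      (0\<^sub>m m (sum_list (map fst n_as))) (0\<^sub>m (sum_list (map fst n_as)) m) (jordan_matrix n_as)"
    unfolding jordan_matrix_def x
    by (simp add: Let_def jordan_matrix_dim[unfolded jordan_matrix_def])
  show ?case
  proof (cases i)
    case 0
    then show ?thesis
      using Cons.prems unfolding J by (auto simp: x block_offset_def)
  next
    case (Suc i')
    have off: "block_offset (x # n_as) i = m + block_offset n_as i'"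
      by (simp add: block_offset_def x Suc)
    show ?thesis
    proof (cases "r < m")
      case True
      have "block_offset n_as i' + j < sum_list (map fst n_as)" if "0 < sum_list (map fst n_as)"
        using Cons.IH[of i' 0] Cons.prems Suc that by auto
      moreover have "0 < sum_list (map fst n_as)"
        using Cons.prems Suc member_le_sum_list[of "fst (n_as ! i')" "map fst n_as"] by force
      ultimately show ?thesis
        using True Cons.prems unfolding J off by (auto simp: x)
    next
      case False
      then show ?thesis
        using Cons.IH[of i' "r - m"] Cons.prems Suc unfolding J off by (auto simp: x)
    qed
  qed
qed

lemma block_offset_surj:
  assumes "k < sum_list (map fst n_as)"
  shows "\<exists>i j. i < length n_as \<and> j < fst (n_as ! i) \<and> k = block_offset n_as i + j"
  using assms
proof (induction n_as arbitrary: k)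
  case Nil
  then show ?case by simp
next
  case (Cons x n_as)
  show ?case
  proof (cases "k < fst x")
    case True
    then show ?thesis
      by (intro exI[of _ 0] exI[of _ k]) (auto simp: block_offset_def)
  next
    case False
    then have "k - fst x < sum_list (map fst n_as)"
      using Cons.prems by simp
    from Cons.IH[OF this] obtain i j where
      "i < length n_as" "j < fst (n_as ! i)" "k - fst x = block_offset n_as i + j"
      by blast
    then show ?thesis
      using False by (intro exI[of _ "Suc i"] exI[of _ j]) (auto simp: block_offset_def)
  qed
qed

text \<open>The matrix of \<open>T\<close> in a basis is similar to a Jordan matrix, \<open>A P = P J\<close>. The columns of \<open>P\<close>
  are the coordinates of the new basis vectors, which are then numbered by block and position in
  the block. Since \<open>P\<close> is invertible they span the space, and there are only as many as the
  dimension, so they are independent and pairwise distinct.\<close>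

lemma jordan_basis_exists:
  fixes T :: "'h::complex_vector \<Rightarrow> 'h"
  assumes fd: "finite_dimensional_vector_space (scaleC :: complex \<Rightarrow> 'h \<Rightarrow> 'h) B"
    and T: "clinear T"
  obtains m :: nat and n l and e :: "nat \<times> nat \<Rightarrow> 'h"
  where "inj_on e (Sigma {..<m} (\<lambda>i. {..<n i}))"
    "complex_vector.independent (e ` Sigma {..<m} (\<lambda>i. {..<n i}))"
    "complex_vector.span (e ` Sigma {..<m} (\<lambda>i. {..<n i})) = UNIV"
    "\<And>i j. i < m \<Longrightarrow> j < n i \<Longrightarrow> T (e (i, j)) = l i *\<^sub>C e (i, j) + (if j = 0 then 0 else e (i, j - 1))"
proof -
  interpret fd: finite_dimensional_vector_space "scaleC :: complex \<Rightarrow> 'h \<Rightarrow> 'h" B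
    by (rule fd)
  interpret T: Vector_Spaces.linear "scaleC :: complex \<Rightarrow> 'h \<Rightarrow> 'h" "scaleC :: complex \<Rightarrow> 'h \<Rightarrow> 'h" T
    by (rule T)
  define N where "N = card B"
  obtain b where b: "bij_betw b {..<N} B"
    unfolding N_def using ex_bij_betw_nat_finite[OF fd.finite_Basis] by (auto simp: atLeast0LessThan)
  have repr: "x = (\<Sum>i<N. complex_vector.representation B x (b i) *\<^sub>C b i)" for x
  proof -
    have "(\<Sum>i<N. complex_vector.representation B x (b i) *\<^sub>C b i) =
        (\<Sum>v\<in>B. complex_vector.representation B x v *\<^sub>C v)"
      by (rule sum.reindex_bij_betw[OF b])
    also have "\<dots> = x"
      by (rule complex_vector.sum_representation_eq[OF fd.independent_Basis])
        (use fd.span_Basis fd.finite_Basis in auto)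
    finally show ?thesis by simp
  qed
  define A where "A = mat N N (\<lambda>(r, k). complex_vector.representation B (T (b k)) (b r))"
  have A: "A \<in> carrier_mat N N"
    by (simp add: A_def)
  have Tb: "T (b k) = (\<Sum>r<N. A $$ (r, k) *\<^sub>C b r)" if "k < N" for k
    using repr[of "T (b k)"] that by (simp add: A_def)
  obtain as where "char_poly A = (\<Prod>a\<leftarrow>as. [:- a, 1:])"
    using char_poly_factorized[OF A] by blast
  then obtain n_as where "jordan_nf A n_as"
    using jordan_nf_exists[OF A] by blast
  then obtain P Q where PQ: "similar_mat_wit A (jordan_matrix n_as) P Q"
    unfolding jordan_nf_def similar_mat_def by blast
  define J where "J = jordan_matrix n_as"
  have P: "P \<in> carrier_mat N N" and Q: "Q \<in> carrier_mat N N" and J: "J \<in> carrier_mat N N"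
    and PQ1: "P * Q = 1\<^sub>m N" and QP1: "Q * P = 1\<^sub>m N" and APJQ: "A = P * J * Q"
    using similar_mat_witD2[OF A PQ] by (auto simp: J_def)
  have "A * P = P * J * (Q * P)"
    unfolding APJQ using P Q J by (simp add: assoc_mult_mat[of _ N N _ N _ N])
  then have AP: "A * P = P * J"
    using P J by (simp add: QP1)
  have N: "sum_list (map fst n_as) = N"
    using J by (metis J_def carrier_matD(1) jordan_matrix_dim(1))
  have mult_index: "(X * Y) $$ (r, k) = (\<Sum>i<N. X $$ (r, i) * Y $$ (i, k))"
    if "X \<in> carrier_mat N N" "Y \<in> carrier_mat N N" "r < N" "k < N" for X Y :: "complex mat" and r k
    using that by (auto simp: scalar_prod_def atLeast0LessThan intro!: sum.cong)
  define f where "f k = (\<Sum>i<N. P $$ (i, k) *\<^sub>C b i)" for k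
  have combine: "(\<Sum>i<N. X $$ (i, k) *\<^sub>C (\<Sum>r<N. Y $$ (r, i) *\<^sub>C b r)) = (\<Sum>r<N. (Y * X) $$ (r, k) *\<^sub>C b r)"
    if "X \<in> carrier_mat N N" "Y \<in> carrier_mat N N" "k < N" for X Y :: "complex mat" and k
  proof -
    have "(\<Sum>i<N. X $$ (i, k) *\<^sub>C (\<Sum>r<N. Y $$ (r, i) *\<^sub>C b r)) =
        (\<Sum>i<N. \<Sum>r<N. (Y $$ (r, i) * X $$ (i, k)) *\<^sub>C b r)"
      by (simp add: complex_vector.scale_sum_right mult.commute)
    also have "\<dots> = (\<Sum>r<N. \<Sum>i<N. (Y $$ (r, i) * X $$ (i, k)) *\<^sub>C b r)"
      by (rule sum.swap)
    also have "\<dots> = (\<Sum>r<N. (Y * X) $$ (r, k) *\<^sub>C b r)"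
      using that by (intro sum.cong) (simp_all add: mult_index complex_vector.scale_sum_left del: index_mult_mat)
    finally show ?thesis .
  qed
  have Tf: "T (f k) = (\<Sum>r<N. J $$ (r, k) *\<^sub>C f r)" if "k < N" for k
  proof -
    have "T (f k) = (\<Sum>i<N. P $$ (i, k) *\<^sub>C (\<Sum>r<N. A $$ (r, i) *\<^sub>C b r))"
      unfolding f_def by (simp add: T.sum T.scale Tb)
    also have "\<dots> = (\<Sum>r<N. (P * J) $$ (r, k) *\<^sub>C b r)"
      using combine[OF P A that] by (simp add: AP)
    also have "\<dots> = (\<Sum>r<N. J $$ (r, k) *\<^sub>C f r)"
      unfolding f_def by (rule combine[OF J P that, symmetric])
    finally show ?thesis .
  qed
  have bf: "b k = (\<Sum>r<N. Q $$ (r, k) *\<^sub>C f r)" if "k < N" for k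
  proof -
    have "(\<Sum>r<N. Q $$ (r, k) *\<^sub>C f r) = (\<Sum>r<N. (if r = k then 1 else 0) *\<^sub>C b r)"
      unfolding f_def using combine[OF Q P that] that by (simp add: PQ1)
    also have "\<dots> = (\<Sum>r<N. if r = k then b r else 0)"
      by (rule sum.cong) auto
    finally show ?thesis
      using that by simp
  qed
  define m where "m = length n_as"
  define n where "n i = fst (n_as ! i)" for i
  define l where "l i = snd (n_as ! i)" for i
  define S where "S = Sigma {..<m} (\<lambda>i. {..<n i})"
  define e where "e = (\<lambda>(i, j). f (block_offset n_as i + j))"
  have e_image: "e ` S = f ` {..<N}"
  proof -
    have "block_offset n_as i + j < N" if "i < m" "j < n i" for i j
      using jordan_matrix_column[of i n_as j 0] member_le_sum_list[of "n i" "map fst n_as"] that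
      by (force simp: m_def n_def N[symmetric])
    then show ?thesis
      using block_offset_surj[of _ n_as] N by (force simp: S_def e_def m_def n_def)
  qed
  have card_S: "card S = N"
    unfolding S_def by (simp add: N[symmetric] sum_list_sum_nth m_def n_def atLeast0LessThan)
  have span_f: "complex_vector.span (f ` {..<N}) = UNIV"
  proof -
    have "b k \<in> complex_vector.span (f ` {..<N})" if "k < N" for k
      unfolding bf[OF that]
      by (intro complex_vector.span_sum complex_vector.span_scale complex_vector.span_base) auto
    then have "B \<subseteq> complex_vector.span (f ` {..<N})"
      using b by (auto simp: bij_betw_def)
    from complex_vector.span_minimal[OF this] fd.span_Basis show ?thesis
      by auto
  qed
  have dimN: "complex_vector.dim (UNIV :: 'h set) = N"
    by (simp add: fd.dim_UNIV N_def fd.dimension_def)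
  have cN: "card (f ` {..<N}) \<le> N"
    using card_image_le[of "{..<N}" f] by simp
  have indep: "complex_vector.independent (f ` {..<N})"
    by (rule fd.card_le_dim_spanning[of _ UNIV]) (use span_f dimN cN in auto)
  have "N \<le> card (f ` {..<N})"
    using complex_vector.dim_le_card[of UNIV "f ` {..<N}"] span_f dimN by auto
  then have "card (e ` S) = card S"
    using cN by (simp add: e_image card_S)
  then have inj: "inj_on e S"
    by (rule eq_card_imp_inj_on[rotated]) (simp add: S_def)
  have Te: "T (e (i, j)) = l i *\<^sub>C e (i, j) + (if j = 0 then 0 else e (i, j - 1))"
    if "i < m" "j < n i" for i j
  proof -
    define k where "k = block_offset n_as i + j"
    have k: "k < N"
      using e_image jordan_matrix_column[of i n_as j 0] member_le_sum_list[of "n i" "map fst n_as"] that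
      by (force simp: m_def n_def N[symmetric] k_def)
    have "T (e (i, j)) = (\<Sum>r<N. J $$ (r, k) *\<^sub>C f r)"
      using Tf[OF k] by (simp add: e_def k_def)
    also have "\<dots> = (\<Sum>r<N. (if r = k then l i *\<^sub>C f r else 0) +
        (if j \<noteq> 0 \<and> r = k - 1 then f r else 0))"
    proof (rule sum.cong[OF refl])
      fix r assume "r \<in> {..<N}"
      then have "J $$ (r, k) = (if r = k then l i else if j \<noteq> 0 \<and> Suc r = k then 1 else 0)"
        using jordan_matrix_column[of i n_as j r] that
        by (simp add: J_def k_def N l_def m_def n_def)
      then show "J $$ (r, k) *\<^sub>C f r = (if r = k then l i *\<^sub>C f r else 0) +
        (if j \<noteq> 0 \<and> r = k - 1 then f r else 0)"
        by (auto simp: k_def)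
    qed
    also have "\<dots> = l i *\<^sub>C f k + (if j = 0 then 0 else f (k - 1))"
      using k by (auto simp: sum.distrib)
    finally show ?thesis
      by (simp add: e_def k_def)
  qed
  show thesis
    by (rule that[of e m n l]) (use inj indep span_f e_image Te in \<open>auto simp: S_def\<close>)
qed

section \<open>Model spaces of finite Blaschke products\<close>

definition Blaschke_product :: "'i set \<Rightarrow> ('i \<Rightarrow> complex) \<Rightarrow> ('i \<Rightarrow> nat) \<Rightarrow> complex \<Rightarrow> complex"
  where "Blaschke_product I a n z = (\<Prod>i\<in>I. ((z - a i) / (1 - cnj (a i) * z)) ^ n i)"

definition kernel_class :: "complex \<Rightarrow> nat \<Rightarrow> circle_L2"
  where "kernel_class a j = abs_circle_L2 (kernel a j)"

lemma cinner_kernel_class: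
  assumes "cmod a < 1" "L2_fun f"
  shows "cinner (abs_circle_L2 f) (kernel_class a j) = Taylor_functional a j f"
  unfolding kernel_class_def Taylor_functional_def
  by (intro cinner_abs assms L2_fun_disk_algebra disk_algebra_kernel)

lemma cinner_kernel_class_left:
  assumes "cmod a < 1" "L2_fun f"
  shows "cinner (kernel_class a j) (abs_circle_L2 f) = cnj (Taylor_functional a j f)"
  by (subst cinner_commute) (simp add: cinner_kernel_class assms)

lemma disk_algebra_Blaschke_factor:
  assumes "cmod a < 1"
  shows "disk_algebra (\<lambda>z. (z - a) / (1 - cnj a * z))"
  using disk_algebra_mult[OF disk_algebra_minus disk_algebra_inverse_linear[of "cnj a"], of a] assms
  by simp

lemma norm_Blaschke_factor:
  assumes "cmod z = 1" "cmod a < 1"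
  shows "cmod ((z - a) / (1 - cnj a * z)) = 1"
proof -
  have "cnj (1 / (1 - cnj a * z)) = z / (z - a)"
    by (rule cnj_inverse_linear_circle[OF assms(1)])
  then have "cmod (1 / (1 - cnj a * z)) = cmod (z / (z - a))"
    by (metis complex_mod_cnj)
  moreover have "cmod ((z - a) / (1 - cnj a * z)) = cmod (z - a) * cmod (1 / (1 - cnj a * z))"
    by (simp add: norm_divide)
  moreover have "z \<noteq> a"
    using assms by auto
  ultimately show ?thesis
    using assms(1) by (simp add: norm_divide)
qed

text \<open>Modulo \<open>(z - a)\<^sup>n\<close> the polynomial \<open>\<psi>\<close> is \<open>c + (z - a)\<close>, and multiplication by \<open>z - a\<close> shifts
  Taylor coefficients by one. In terms of the first \<open>n\<close> coefficients, multiplication by \<open>\<psi>\<close> is therefore a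
  Jordan block with eigenvalue \<open>c\<close>.\<close>

lemma Taylor_functional_poly_mult:
  assumes a: "cmod a < 1" and dvd: "[:- a, 1:] ^ n dvd \<psi> - [:c - a, 1:]"
    and f: "Hardy_boundary f" and j: "j < n"
  shows "Taylor_functional a j (\<lambda>z. poly \<psi> z * f z) =
    c * Taylor_functional a j f + (if j = 0 then 0 else Taylor_functional a (j - 1) f)"
proof -
  obtain s where s: "\<psi> - [:c - a, 1:] = [:- a, 1:] ^ n * s"
    using dvd by (auto elim: dvdE)
  have eq: "poly \<psi> z * f z = (c * f z + (z - a) * f z) + (z - a) ^ n * (poly s z * f z)" for z
  proof -
    have "poly \<psi> z - (c - a + z) = (z - a) ^ n * poly s z"
      using arg_cong[OF s, of "\<lambda>p. poly p z"] by (simp add: poly_power)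
    then have "poly \<psi> z = (c + (z - a)) + (z - a) ^ n * poly s z"
      by (simp add: algebra_simps)
    then show ?thesis
      by (simp only: distrib_right mult.assoc)
  qed
  have f2: "L2_fun f"
    by (rule Hardy_boundary_L2[OF f])
  have af: "L2_fun (\<lambda>z. (z - a) * f z)" and sf: "Hardy_boundary (\<lambda>z. poly s z * f z)"
    and nsf: "L2_fun (\<lambda>z. (z - a) ^ n * (poly s z * f z))"
    by (intro L2_fun_disk_algebra_mult Hardy_boundary_mult disk_algebra_power disk_algebra_minus
        disk_algebra_poly f f2)+
  have "Taylor_functional a j (\<lambda>z. poly \<psi> z * f z) =
      c * Taylor_functional a j f + Taylor_functional a j (\<lambda>z. (z - a) * f z)
      + Taylor_functional a j (\<lambda>z. (z - a) ^ n * (poly s z * f z))"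
    unfolding eq
    by (simp add: Taylor_functional_add[OF a] Taylor_functional_scale L2_fun_add L2_fun_scale f2 af nsf)
  also have "Taylor_functional a j (\<lambda>z. (z - a) ^ n * (poly s z * f z)) = 0"
    by (rule Taylor_functional_power_mult[OF a sf j])
  also have "Taylor_functional a j (\<lambda>z. (z - a) * f z) = (if j = 0 then 0 else Taylor_functional a (j - 1) f)"
    using Taylor_functional_power_mult[OF a f, of 0 1] Taylor_functional_linear_mult[OF a, of "j - 1" f]
    by (cases j) simp_all
  finally show ?thesis
    by simp
qed

text \<open>The zeros are distinct points \<open>a i\<close> with multiplicities \<open>n i\<close>.\<close>

locale Blaschke_data =
  fixes I :: "'i set" and a :: "'i \<Rightarrow> complex" and n :: "'i \<Rightarrow> nat"
  assumes finite_I: "finite I" and inj_a: "inj_on a I" and a_disk: "\<And>i. i \<in> I \<Longrightarrow> cmod (a i) < 1"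
begin

abbreviation \<Theta> :: "complex \<Rightarrow> complex"
  where "\<Theta> \<equiv> Blaschke_product I a n"

abbreviation index :: "('i \<times> nat) set"
  where "index \<equiv> Sigma I (\<lambda>i. {..<n i})"

abbreviation kern :: "'i \<times> nat \<Rightarrow> circle_L2"
  where "kern x \<equiv> kernel_class (a (fst x)) (snd x)"

lemma finite_index: "finite index"
  using finite_I by auto

lemma disk_algebra_Blaschke: "disk_algebra \<Theta>"
  unfolding Blaschke_product_def[abs_def]
  by (intro disk_algebra_prod disk_algebra_power disk_algebra_Blaschke_factor a_disk)

lemma norm_Blaschke:
  assumes "cmod z = 1"
  shows "cmod (\<Theta> z) = 1"
  using norm_Blaschke_factor[OF assms a_disk]
  by (simp add: Blaschke_product_def prod_norm[symmetric] norm_power)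

lemma inner_function_Blaschke: "inner_function \<Theta>"
  unfolding inner_function_def
  using disk_algebra_Hardy_inf[OF disk_algebra_Blaschke] disk_algebra_boundary_value[OF disk_algebra_Blaschke]
    norm_Blaschke
  by (intro conjI AE_I2) auto

text \<open>The product has a zero, but in the infinite disk it vanishes only at finitely many points.\<close>

lemma Blaschke_nonconstant:
  assumes "i \<in> I" "n i \<noteq> 0"
  shows "\<not> \<Theta> constant_on ball 0 1"
proof
  assume "\<Theta> constant_on ball 0 1"
  then obtain c where c: "\<And>z. z \<in> ball 0 1 \<Longrightarrow> \<Theta> z = c"
    by (auto simp: constant_on_def)
  have "\<Theta> (a i) = 0"
    unfolding Blaschke_product_def
    by (rule prod_zero) (use finite_I assms in auto)
  then have 0: "\<Theta> z = 0" if "z \<in> ball 0 1" for z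
    using c[of "a i"] c[OF that] a_disk[OF assms(1)] by simp
  have "ball 0 1 \<noteq> (\<lambda>i. a i) ` I"
  proof
    assume "ball 0 1 = (\<lambda>i. a i) ` I"
    then have "finite (ball (0 :: complex) 1)"
      using finite_I by simp
    then show False
      by (simp add: uncountable_ball countable_finite uncountable_infinite)
  qed
  moreover have "a ` I \<subseteq> ball 0 1"
    using a_disk by auto
  ultimately obtain z where z: "z \<in> ball 0 1" "z \<notin> a ` I"
    by blast
  have "(z - a i) / (1 - cnj (a i) * z) \<noteq> 0" if "i \<in> I" for i
  proof -
    have "cnj (a i) * z \<noteq> 1"
    proof
      assume "cnj (a i) * z = 1"
      then have "cmod (a i) * cmod z = 1"
        by (metis norm_mult norm_one complex_mod_cnj)
      moreover have "cmod (a i) * cmod z \<le> cmod (a i)"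
        using z by (simp add: mult_left_le)
      ultimately show False
        using a_disk[OF that] by simp
    qed
    then show ?thesis
      using z that by auto
  qed
  then have "\<Theta> z \<noteq> 0"
    unfolding Blaschke_product_def using finite_I by simp
  with 0[OF z(1)] show False
    by simp
qed

text \<open>Every multiple of \<open>\<Theta>\<close> has a zero of order \<open>n i\<close> at \<open>a i\<close>, so its first \<open>n i\<close> Taylor coefficients
  there vanish.\<close>

lemma kernel_in_model_space:
  assumes "i \<in> I" "j < n i"
  shows "kernel_class (a i) j \<in> model_space \<Theta>"
  unfolding model_space_iff[OF disk_algebra_Blaschke]
proof (intro conjI allI impI)
  show "kernel_class (a i) j \<in> Hardy2"
    unfolding kernel_class_def
    by (intro abs_in_Hardy2 Hardy_boundary_disk_algebra disk_algebra_kernel a_disk assms)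
  fix h assume h: "Hardy_boundary h"
  define s where "s z = (1 / (1 - cnj (a i) * z)) ^ n i * Blaschke_product (I - {i}) a n z" for z
  have "disk_algebra s"
    unfolding s_def[abs_def] Blaschke_product_def[abs_def]
    by (intro disk_algebra_mult disk_algebra_prod disk_algebra_power disk_algebra_Blaschke_factor
        disk_algebra_inverse_linear) (use a_disk assms in auto)
  then have sh: "Hardy_boundary (\<lambda>z. s z * h z)"
    by (rule Hardy_boundary_mult[OF _ h])
  have "\<Theta> z * h z = (z - a i) ^ n i * (s z * h z)" for z
    unfolding Blaschke_product_def s_def
    by (subst prod.remove[OF finite_I assms(1)]) (simp add: power_divide)
  then have "Taylor_functional (a i) j (\<lambda>z. \<Theta> z * h z) = 0"
    using Taylor_functional_power_mult[OF a_disk[OF assms(1)] sh assms(2)] by (simp only:)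
  moreover have "L2_fun (\<lambda>z. \<Theta> z * h z)"
    by (intro L2_fun_disk_algebra_mult disk_algebra_Blaschke Hardy_boundary_L2 h)
  ultimately show "cinner (kernel_class (a i) j) (abs_circle_L2 (\<lambda>z. \<Theta> z * h z)) = 0"
    by (simp add: cinner_kernel_class_left a_disk assms)
qed

text \<open>Orthogonality to the kernels means that \<open>F\<close> vanishes at the zeros of \<open>\<Theta>\<close> to the full order.
  Then \<open>F\<close> is divisible by \<open>\<Theta>\<close> in $H^2$, and as a member of the model space it is orthogonal to
  itself.\<close>

lemma orthogonal_kernels_eq_0:
  assumes F: "F \<in> model_space \<Theta>" and orth: "\<And>x. x \<in> index \<Longrightarrow> cinner F (kern x) = 0"
  shows "F = 0"
proof -
  define f where "f = rep_circle_L2 F"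
  have absf: "F = abs_circle_L2 f"
    by (simp add: f_def abs_rep)
  have f: "Hardy_boundary f"
    using F by (simp add: model_space_iff[OF disk_algebra_Blaschke] Hardy2_iff f_def)
  have "Taylor_functional (a i) j f = 0" if "i \<in> I" "j < n i" for i j
    using orth[of "(i, j)"] that by (simp add: absf cinner_kernel_class a_disk Hardy_boundary_L2[OF f])
  then have g: "Hardy_boundary (\<lambda>z. f z / poly (\<Prod>i\<in>I. [:- a i, 1:] ^ n i) z)"
    by (intro Hardy_boundary_divide_prod finite_I inj_a a_disk f)
  \<comment> \<open>The quotient \<open>f / \<Theta>\<close>, arranged as a polynomial multiple of a function known to lie in $H^2$.\<close>
  define h where "h z = (\<Prod>i\<in>I. (1 - cnj (a i) * z) ^ n i) * (f z / poly (\<Prod>i\<in>I. [:- a i, 1:] ^ n i) z)" for z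
  have "disk_algebra (\<lambda>z. \<Prod>i\<in>I. (1 + (- cnj (a i)) * z) ^ n i)"
    by (intro disk_algebra_prod disk_algebra_power disk_algebra_linear)
  then have h: "Hardy_boundary h"
    unfolding h_def[abs_def] by (intro Hardy_boundary_mult g) simp
  have "f z = \<Theta> z * h z" if z: "cmod z = 1" for z
  proof -
    have "h z = f z / \<Theta> z"
      by (simp add: h_def Blaschke_product_def poly_prod poly_power power_divide prod_dividef)
    then show ?thesis
      using norm_Blaschke[OF z] by auto
  qed
  then have "F = abs_circle_L2 (\<lambda>z. \<Theta> z * h z)"
    unfolding absf by (intro abs_eqI L2_eqI_circle Hardy_boundary_L2 f)
  moreover have "cinner F (abs_circle_L2 (\<lambda>z. \<Theta> z * h z)) = 0"
    using F h by (simp add: model_space_iff[OF disk_algebra_Blaschke])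
  ultimately show ?thesis
    by (metis cinner_eq_zero_iff)
qed

lemma model_space_eq_span: "model_space \<Theta> = complex_vector.span (kern ` index)"
proof
  show sub: "complex_vector.span (kern ` index) \<subseteq> model_space \<Theta>"
    by (intro complex_vector.span_minimal subspace_model_space) (auto intro: kernel_in_model_space)
  show "model_space \<Theta> \<subseteq> complex_vector.span (kern ` index)"
  proof
    fix F assume F: "F \<in> model_space \<Theta>"
    obtain G where G: "G \<in> complex_vector.span (kern ` index)"
      "\<And>K. K \<in> kern ` index \<Longrightarrow> cinner (F - G) K = 0"
      using orthogonal_projection_on_span[of "kern ` index" F] finite_index by blast
    have "F - G \<in> model_space \<Theta>"
      using complex_vector.subspace_diff[OF subspace_model_space F] G(1) sub by blast
    then have "F - G = 0"
      by (rule orthogonal_kernels_eq_0) (use G(2) in blast)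
    then show "F \<in> complex_vector.span (kern ` index)"
      using G(1) by simp
  qed
qed

text \<open>Pairing with polynomials that have a single nonzero Taylor coefficient among those indexed by
  \<open>index\<close> isolates the coefficients of a linear relation.\<close>

lemma kernels_independent:
  assumes "(\<Sum>x\<in>index. c x *\<^sub>C kern x) = 0" and y: "y \<in> index"
  shows "c y = 0"
proof -
  obtain i j where ij: "y = (i, j)" "i \<in> I" "j < n i"
    using y by auto
  have "\<exists>p. \<forall>i'\<in>I. [:- a i', 1:] ^ n i' dvd p - (if i' = i then [:- a i, 1:] ^ j else 0)"
    by (rule chinese_remainder_poly[OF finite_I coprime_linear_poly_powers])
      (use inj_a in \<open>auto simp: inj_on_def\<close>)
  then obtain p where p: "\<And>i'. i' \<in> I \<Longrightarrow> [:- a i', 1:] ^ n i' dvd p - (if i' = i then [:- a i, 1:] ^ j else 0)"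
    by blast
  have Tp: "Taylor_functional (a i') j' (poly p) = (if (i', j') = (i, j) then 1 else 0)"
    if i': "i' \<in> I" and j': "j' < n i'" for i' j'
  proof -
    obtain s where s: "p - (if i' = i then [:- a i, 1:] ^ j else 0) = [:- a i', 1:] ^ n i' * s"
      using p[OF i'] by (auto elim: dvdE)
    have eq: "poly p z = (if i' = i then 1 else 0) * (z - a i) ^ j + (z - a i') ^ n i' * poly s z" for z
      using arg_cong[OF s, of "\<lambda>p. poly p z"]
      by (auto simp: poly_power algebra_simps split: if_splits)
    have "Taylor_functional (a i') j' (poly p) =
        Taylor_functional (a i') j' (\<lambda>z. (if i' = i then 1 else 0) * (z - a i) ^ j + (z - a i') ^ n i' * poly s z)"
      by (rule Taylor_functional_cong) (rule eq)
    also have "\<dots> = (if i' = i then 1 else 0) * Taylor_functional (a i') j' (\<lambda>z. (z - a i) ^ j)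
        + Taylor_functional (a i') j' (\<lambda>z. (z - a i') ^ n i' * poly s z)"
      unfolding Taylor_functional_scale[symmetric]
      by (intro Taylor_functional_add a_disk i' L2_fun_scale L2_fun_disk_algebra
          disk_algebra_mult disk_algebra_power disk_algebra_minus disk_algebra_poly)
    also have "Taylor_functional (a i') j' (\<lambda>z. (z - a i') ^ n i' * poly s z) = 0"
      by (intro Taylor_functional_power_mult a_disk i' j' Hardy_boundary_disk_algebra disk_algebra_poly)
    finally show ?thesis
      using Taylor_functional_power[OF a_disk[OF ij(2)], of j' j] by auto
  qed
  have pL2: "L2_fun (poly p)"
    by (intro L2_fun_disk_algebra disk_algebra_poly)
  have "0 = cinner (abs_circle_L2 (poly p)) (\<Sum>x\<in>index. c x *\<^sub>C kern x)"
    using assms(1) by (simp add: cinner_zero_right)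
  also have "\<dots> = (\<Sum>x\<in>index. cnj (c x) * Taylor_functional (a (fst x)) (snd x) (poly p))"
    unfolding cinner_sum_right
    by (intro sum.cong) (auto simp: cinner_scaleC_right cinner_kernel_class a_disk pL2)
  also have "\<dots> = (\<Sum>x\<in>index. if x = y then cnj (c x) else 0)"
    by (intro sum.cong) (auto simp: Tp ij(1) split: if_splits)
  also have "\<dots> = cnj (c y)"
    using y finite_index by simp
  finally show ?thesis
    by simp
qed

end

section \<open>Operators as co-analytic truncated Toeplitz operators\<close>

text \<open>Below, \<open>inv\<close> denotes the inverse of a function and not the inverse in a group.\<close>

unbundle no m_inv_syntax

theorem theorem6p1:
  fixes T :: "'h::{complex_inner, complete_space} \<Rightarrow> 'h"
  assumes nonzero: "\<exists>x::'h. x \<noteq> 0"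
    and findim: "\<exists>B. finite_dimensional_vector_space (scaleC :: complex \<Rightarrow> 'h \<Rightarrow> 'h) B"
    and linear: "clinear T"
  shows "\<exists>\<Theta> \<psi>. \<exists>X :: 'h \<Rightarrow> circle_L2.
    inner_function \<Theta> \<and> \<not> \<Theta> constant_on ball 0 1 \<and> \<psi> \<in> Hardy_inf \<and>
    clinear X \<and> bij_betw X UNIV (model_space \<Theta>) \<and>
    (\<forall>F\<in>model_space \<Theta>.
      X (T (inv X F)) = truncated_Toeplitz \<Theta> (\<lambda>z. cnj (boundary \<psi> z)) F)"
proof -
  interpret T: Vector_Spaces.linear "scaleC :: complex \<Rightarrow> 'h \<Rightarrow> 'h" "scaleC :: complex \<Rightarrow> 'h \<Rightarrow> 'h" T
    by (rule linear)
  interpret pair: vector_space_pair "scaleC :: complex \<Rightarrow> 'h \<Rightarrow> 'h" "scaleC :: complex \<Rightarrow> circle_L2 \<Rightarrow> circle_L2"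
    by unfold_locales
  obtain B where B: "finite_dimensional_vector_space (scaleC :: complex \<Rightarrow> 'h \<Rightarrow> 'h) B"
    using findim by blast
  obtain m n l and e :: "nat \<times> nat \<Rightarrow> 'h" where
    inj: "inj_on e (Sigma {..<m} (\<lambda>i. {..<n i}))" and
    indep: "complex_vector.independent (e ` Sigma {..<m} (\<lambda>i. {..<n i}))" and
    span: "complex_vector.span (e ` Sigma {..<m} (\<lambda>i. {..<n i})) = UNIV" and
    Te: "\<And>i j. i < m \<Longrightarrow> j < n i \<Longrightarrow> T (e (i, j)) = l i *\<^sub>C e (i, j) + (if j = 0 then 0 else e (i, j - 1))"
    by (rule jordan_basis_exists[OF B linear]) (rule that; assumption)
  \<comment> \<open>Any distinct points of the disk may serve as zeros, one for each Jordan block.\<close>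
  define a :: "nat \<Rightarrow> complex" where "a i = complex_of_real (1 / (real i + 2))" for i
  interpret Blaschke_data "{..<m}" a n
  proof
    show "inj_on a {..<m}"
      unfolding inj_on_def a_def of_real_eq_iff by (auto simp: field_simps)
    show "cmod (a i) < 1" for i
      unfolding a_def norm_of_real by simp
  qed simp
  \<comment> \<open>Near \<open>a i\<close> the symbol is \<open>cnj (l i) + (z - a i)\<close> up to order \<open>n i\<close>. The eigenvalue is conjugated because the Toeplitz operator has the conjugate symbol.\<close>
  have "\<exists>\<psi>. \<forall>i\<in>{..<m}. [:- a i, 1:] ^ n i dvd \<psi> - [:cnj (l i) - a i, 1:]"
    by (rule chinese_remainder_poly[OF finite_I coprime_linear_poly_powers])
      (use inj_a in \<open>auto simp: inj_on_def\<close>)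
  then obtain \<psi> where \<psi>: "\<And>i. i < m \<Longrightarrow> [:- a i, 1:] ^ n i dvd \<psi> - [:cnj (l i) - a i, 1:]"
    by blast
  from pair.linear_independent_extend[OF indep, of "\<lambda>v. kern (the_inv_into index e v)"]
  obtain X where X: "clinear X" and "\<forall>v\<in>e ` index. X v = kern (the_inv_into index e v)"
    by blast
  then have Xe: "X (e x) = kern x" if "x \<in> index" for x
    using that the_inv_into_f_f[OF inj that] by auto
  interpret X: Vector_Spaces.linear "scaleC :: complex \<Rightarrow> 'h \<Rightarrow> 'h" "scaleC :: complex \<Rightarrow> circle_L2 \<Rightarrow> circle_L2" X
    by (rule X)
  have range: "range X = model_space \<Theta>"
  proof -
    have "range X = complex_vector.span (X ` (e ` index))"
      using X.span_image[of "e ` index"] span by simp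
    also have "X ` (e ` index) = kern ` index"
      unfolding image_image by (rule image_cong[OF refl]) (rule Xe)
    finally show ?thesis
      by (simp only: model_space_eq_span)
  qed
  have injX: "inj X"
    unfolding X.inj_iff_eq_0
  proof (intro allI impI)
    fix v assume v: "X v = 0"
    have "v \<in> complex_vector.span (e ` index)"
      by (simp add: span)
    then obtain u where "v = (\<Sum>w\<in>e ` index. u w *\<^sub>C w)"
      using complex_vector.span_finite[of "e ` index"] finite_index by auto
    then have u: "v = (\<Sum>x\<in>index. u (e x) *\<^sub>C e x)"
      by (simp add: sum.reindex[OF inj])
    have "(\<Sum>x\<in>index. u (e x) *\<^sub>C kern x) = (\<Sum>x\<in>index. u (e x) *\<^sub>C X (e x))"
      by (intro sum.cong) (simp_all only: Xe)
    also have "\<dots> = X v"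
      unfolding u by (simp only: X.sum X.scale)
    finally have "u (e x) = 0" if "x \<in> index" for x
      using kernels_independent[of "\<lambda>x. u (e x)"] v that by simp
    then show "v = 0"
      unfolding u by (intro sum.neutral) auto
  qed
  \<comment> \<open>The intertwining relation tested against $H^2$; by linearity it is enough to check it on the Jordan basis.\<close>
  have inter: "cinner (X v) (abs_circle_L2 (\<lambda>z. poly \<psi> z * f z)) = cinner (X (T v)) (abs_circle_L2 f)"
    if f: "Hardy_boundary f" for f v
  proof -
    let ?V = "{v. cinner (X v) (abs_circle_L2 (\<lambda>z. poly \<psi> z * f z)) = cinner (X (T v)) (abs_circle_L2 f)}"
    have f2: "L2_fun f" and \<psi>f2: "L2_fun (\<lambda>z. poly \<psi> z * f z)"
      by (intro L2_fun_disk_algebra_mult disk_algebra_poly Hardy_boundary_L2 f)+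
    have "e ` index \<subseteq> ?V"
    proof clarsimp
      fix i j assume ij: "i < m" "j < n i"
      have ai: "cmod (a i) < 1"
        using a_disk ij by auto
      have "cinner (X (e (i, j))) (abs_circle_L2 (\<lambda>z. poly \<psi> z * f z)) =
          l i * cnj (Taylor_functional (a i) j f) + (if j = 0 then 0 else cnj (Taylor_functional (a i) (j - 1) f))"
        using Taylor_functional_poly_mult[OF ai \<psi>[OF ij(1)] f ij(2)] ij
        by (simp add: Xe cinner_kernel_class_left[OF ai \<psi>f2])
      also have "\<dots> = cinner (X (T (e (i, j)))) (abs_circle_L2 f)"
        using ij
        by (simp add: Te X.add X.scale X.zero Xe cinner_add_left cinner_scaleC_left
            cinner_zero_left cinner_kernel_class_left[OF ai f2])
      finally show "cinner (X (e (i, j))) (abs_circle_L2 (\<lambda>z. poly \<psi> z * f z)) =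
          cinner (X (T (e (i, j)))) (abs_circle_L2 f)" .
    qed
    moreover have "complex_vector.subspace ?V"
      by (rule complex_vector.subspaceI)
        (simp_all add: T.zero T.add T.scale X.zero X.add X.scale cinner_add_left cinner_scaleC_left
          cinner_zero_left)
    ultimately have "complex_vector.span (e ` index) \<subseteq> ?V"
      by (rule complex_vector.span_minimal)
    then show ?thesis
      using span by auto
  qed
  have toeplitz: "truncated_Toeplitz \<Theta> (\<lambda>z. cnj (boundary (poly \<psi>) z)) (X v) = X (T v)" for v
    unfolding truncated_Toeplitz_def
  proof (rule orth_proj_eqI[OF subspace_model_space])
    show "X (T v) \<in> model_space \<Theta>"
      using range by blast
    fix F assume "F \<in> model_space \<Theta>"
    then have "F \<in> Hardy2"
      by (simp add: model_space_def)
    then obtain f where f: "Hardy_boundary f" "F = abs_circle_L2 f"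
      by (rule Hardy2E)
    have "cinner (L2_mult (\<lambda>z. cnj (boundary (poly \<psi>) z)) (X v)) F =
        cinner (X v) (abs_circle_L2 (\<lambda>z. poly \<psi> z * f z))"
      using cinner_L2_mult_cnj[OF disk_algebra_poly[of \<psi>], of "\<lambda>z. cnj (boundary (poly \<psi>) z)"
          "rep_circle_L2 (X v)" f]
      by (simp add: boundary_disk_algebra disk_algebra_poly L2_fun_rep Hardy_boundary_L2 f abs_rep)
    also have "\<dots> = cinner (X (T v)) F"
      unfolding f(2) by (rule inter[OF f(1)])
    finally show "cinner (L2_mult (\<lambda>z. cnj (boundary (poly \<psi>) z)) (X v) - X (T v)) F = 0"
      by (simp add: cinner_diff_left)
  qed
  have nonconst: "\<not> \<Theta> constant_on ball 0 1"
  proof -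
    have "index \<noteq> {}"
    proof
      assume "index = {}"
      then have "(UNIV :: 'h set) = {0}"
        using span by simp
      with nonzero show False
        by auto
    qed
    then show ?thesis
      using Blaschke_nonconstant by fastforce
  qed
  have "bij_betw X UNIV (model_space \<Theta>)"
    using injX range by (simp add: bij_betw_def)
  moreover have "X (T (inv X F)) = truncated_Toeplitz \<Theta> (\<lambda>z. cnj (boundary (poly \<psi>) z)) F"
    if "F \<in> model_space \<Theta>" for F
    using toeplitz[of "inv X F"] f_inv_into_f[of F X UNIV] that range by simp
  ultimately show ?thesis
    using inner_function_Blaschke nonconst disk_algebra_Hardy_inf[OF disk_algebra_poly[of \<psi>]] X
    by blast
qed

end
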